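(* Let $d\ge1$, $m>0$. Any entropy solution $u$ (in the sense defined in the context) of $$\partial_t u-\operatorname{div}(u^m\nabla \mathsf g\ast u)=0 \ \text{ in } (0,\infty)\times\mathbb{T}^d,\qquad u|_{t=0}=u_0,$$ with initial condition $u_0\ge0$ and $\bar u_0:=\int_{\mathbb{T}^d}u_0\,dx$, satisfies the following estimates: 1. (instantaneous regularization) $u(t,x)\le\bar u_0+(mt)^{-1/m}$ for a.e. $t>0$, $x\in\mathbb{T}^d$; 2. (decreasing of $L^p$ norms) for every $1\le p\le\infty$, $t\mapsto\|u(t)\|_{L^p}$ is nonincreasing; 3. (lower barrier) if $m<1$, then there is a constant $C>0$, depending at most on $m$ and $\bar u_0$ (in particular not on $t,x$), such that for a.e. $t>0$ and $x\in\mathbb{T}^d$ $$u(t,x)\ge C\min\Big((\bar u_0t)^{\frac1{1-m}},\ \bar u_0\,(1-e^{-Ct})\Big).$$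
   Context: $\mathbb{T}^d=\mathbb{R}^d/\mathbb{Z}^d$ is the $d$-dimensional torus of unit volume; $\mathsf g$ is the mean-zero Green kernel on $\mathbb{T}^d$, i.e. $-\Delta\mathsf g=\delta_0-1$; convolution is in the space variable. $\bar u=\int_{\mathbb{T}^d}u\,dx$ denotes the spatial average of $u$. Entropy solution with initial datum $u_0$: a function $u$ such that (1) $u\ge0$ and $u\in L^\infty(\mathbb{R}_+\times\mathbb{T}^d)$; (2) for every $T>0$ and $\varphi\in C^1_c([0,T)\times\mathbb{T}^d)$, $\int_0^T\int_{\mathbb{T}^d}[-u\,\partial_t\varphi+u^m\,\nabla\mathsf g\ast u\cdot\nabla\varphi]\,dx\,dt=\int_{\mathbb{T}^d}u_0(x)\varphi(0,x)\,dx$; (3) for all convex $\eta\in C^2$ and $q$ with $q'(\xi)=m\,\eta'(\xi)\xi^{m-1}$, in the sense of distributions, $\partial_t\eta(u)\le\operatorname{div}(q(u)\nabla\mathsf g\ast u)+(q(u)-\eta'(u)u^m)(u-\bar u)$. *)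

theory Defs
  imports "HOL-Probability.Probability"
begin

(*
  The dimension d is a natural number, not an index type, so that it can be quantified inside a
  formula.  Points of R^d are the extensional functions on {..<d}; the topology on them is the
  product topology.  The torus R^d / Z^d is the unit cube [0,1)^d with Lebesgue measure, its group
  law being computed modulo 1.
*)

type_synonym point = "nat \<Rightarrow> real"

definition euclid :: "nat \<Rightarrow> point set" where
  "euclid d = PiE {..<d} (\<lambda>_. UNIV)"

definition torus :: "nat \<Rightarrow> point measure" where
  "torus d = (\<Pi>\<^sub>M i\<in>{..<d}. restrict_space lborel {0..<1})"

definition torus_zero :: "nat \<Rightarrow> point" where
  "torus_zero d = (\<lambda>i\<in>{..<d}. 0)"

definition torus_diff :: "nat \<Rightarrow> point \<Rightarrow> point \<Rightarrow> point" where
  "torus_diff d x y = (\<lambda>i\<in>{..<d}. frac (x i - y i))"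

definition torus_mean :: "nat \<Rightarrow> (point \<Rightarrow> real) \<Rightarrow> real" where
  "torus_mean d f = (LINT x|torus d. f x)"

definition spacetime :: "nat \<Rightarrow> (real \<times> point) measure" where
  "spacetime d = restrict_space lborel {0<..} \<Otimes>\<^sub>M torus d"

definition Lp_norm :: "nat \<Rightarrow> ereal \<Rightarrow> (point \<Rightarrow> real) \<Rightarrow> ereal" where
  "Lp_norm d p f =
     (if p = \<infinity> then esssup (torus d) (\<lambda>x. ereal \<bar>f x\<bar>)
      else if integrable (torus d) (\<lambda>x. \<bar>f x\<bar> powr real_of_ereal p)
      then ereal ((LINT x|torus d. \<bar>f x\<bar> powr real_of_ereal p) powr (1 / real_of_ereal p))
      else \<infinity>)"


text \<open>
  Functions that are to be differentiated are represented by their periodic lifts to \<open>euclid d\<close>.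
\<close>

definition periodic :: "nat \<Rightarrow> (point \<Rightarrow> real) \<Rightarrow> bool" where
  "periodic d f \<longleftrightarrow> (\<forall>x\<in>euclid d. \<forall>i<d. f (x(i := x i + 1)) = f x)"

definition partial_x :: "nat \<Rightarrow> (point \<Rightarrow> real) \<Rightarrow> point \<Rightarrow> real" where
  "partial_x i f x = deriv (\<lambda>s. f (x(i := s))) (x i)"

text \<open>The time derivative is one-sided at time 0.\<close>

definition partial_t :: "(real \<Rightarrow> point \<Rightarrow> real) \<Rightarrow> real \<Rightarrow> point \<Rightarrow> real" where
  "partial_t \<phi> t x = vector_derivative (\<lambda>s. \<phi> s x) (at t within {0..})"

text \<open>\<open>Ck d k \<phi>\<close>: the function \<open>\<phi>\<close> is of class $C^k$ on $[0,\infty) \times T^d$.\<close>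

fun Ck :: "nat \<Rightarrow> nat \<Rightarrow> (real \<Rightarrow> point \<Rightarrow> real) \<Rightarrow> bool" where
  "Ck d 0 \<phi> \<longleftrightarrow>
     (\<forall>t\<ge>0. periodic d (\<phi> t)) \<and>
     continuous_on ({0..} \<times> euclid d) (\<lambda>(t, x). \<phi> t x)"
| "Ck d (Suc k) \<phi> \<longleftrightarrow>
     Ck d 0 \<phi> \<and>
     (\<forall>t\<ge>0. \<forall>x\<in>euclid d.
        (\<lambda>s. \<phi> s x) differentiable (at t within {0..}) \<and>
        (\<forall>i<d. (\<lambda>s. \<phi> t (x(i := s))) differentiable (at (x i)))) \<and>
     Ck d k (partial_t \<phi>) \<and>
     (\<forall>i<d. Ck d k (\<lambda>t. partial_x i (\<phi> t)))"

definition smooth_torus :: "nat \<Rightarrow> (point \<Rightarrow> real) \<Rightarrow> bool" where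
  "smooth_torus d \<psi> \<longleftrightarrow> (\<forall>k. Ck d k (\<lambda>_. \<psi>))"

text \<open>$C^1_c([0,T) \times T^d)$, each function being extended by 0 to later times\<close>

definition test_C1 :: "nat \<Rightarrow> real \<Rightarrow> (real \<Rightarrow> point \<Rightarrow> real) \<Rightarrow> bool" where
  "test_C1 d T \<phi> \<longleftrightarrow>
     Ck d 1 \<phi> \<and> (\<exists>S<T. \<forall>t\<ge>S. \<forall>x\<in>euclid d. \<phi> t x = 0)"

text \<open>Nonnegative elements of $C^\infty_c((0,\infty) \times T^d)$, extended by 0 to time 0\<close>

definition test_nonneg :: "nat \<Rightarrow> (real \<Rightarrow> point \<Rightarrow> real) \<Rightarrow> bool" where
  "test_nonneg d \<phi> \<longleftrightarrow>
     (\<forall>k. Ck d k \<phi>) \<and>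
     (\<forall>t\<ge>0. \<forall>x\<in>euclid d. 0 \<le> \<phi> t x) \<and>
     (\<exists>a>0. \<exists>b. \<forall>t\<ge>0. t \<notin> {a..b} \<longrightarrow> (\<forall>x\<in>euclid d. \<phi> t x = 0))"


text \<open>$-\Delta g = \delta_0 - 1$ in the sense of distributions on the torus, with mean zero\<close>

definition green_kernel :: "nat \<Rightarrow> (point \<Rightarrow> real) \<Rightarrow> bool" where
  "green_kernel d g \<longleftrightarrow>
     integrable (torus d) g \<and> torus_mean d g = 0 \<and>
     (\<forall>\<psi>. smooth_torus d \<psi> \<longrightarrow>
        - (LINT x|torus d. g x * (\<Sum>i<d. partial_x i (partial_x i \<psi>) x))
        = \<psi> (torus_zero d) - torus_mean d \<psi>)"

text \<open>\<open>K i\<close> is the \<open>i\<close>-th distributional partial derivative of \<open>g\<close>; it is unique up to null sets.\<close>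

definition weak_gradient :: "nat \<Rightarrow> (point \<Rightarrow> real) \<Rightarrow> (nat \<Rightarrow> point \<Rightarrow> real) \<Rightarrow> bool" where
  "weak_gradient d g K \<longleftrightarrow>
     (\<forall>i<d. integrable (torus d) (K i) \<and>
        (\<forall>\<psi>. smooth_torus d \<psi> \<longrightarrow>
           (LINT x|torus d. g x * partial_x i \<psi> x) = - (LINT x|torus d. K i x * \<psi> x)))"

definition torus_conv :: "nat \<Rightarrow> (point \<Rightarrow> real) \<Rightarrow> (point \<Rightarrow> real) \<Rightarrow> point \<Rightarrow> real" where
  "torus_conv d f h x = (LINT y|torus d. f (torus_diff d x y) * h y)"


definition bounded_nonneg :: "nat \<Rightarrow> (real \<Rightarrow> point \<Rightarrow> real) \<Rightarrow> bool" where
  "bounded_nonneg d u \<longleftrightarrow>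
     (\<lambda>(t, x). u t x) \<in> borel_measurable (spacetime d) \<and>
     (AE (t, x) in spacetime d. 0 \<le> u t x) \<and>
     (\<exists>M. AE (t, x) in spacetime d. u t x \<le> M)"

definition weak_formulation ::
  "nat \<Rightarrow> real \<Rightarrow> (nat \<Rightarrow> point \<Rightarrow> real) \<Rightarrow> (point \<Rightarrow> real) \<Rightarrow> (real \<Rightarrow> point \<Rightarrow> real) \<Rightarrow> bool" where
  "weak_formulation d m K u0 u \<longleftrightarrow>
     (\<forall>T>0. \<forall>\<phi>. test_C1 d T \<phi> \<longrightarrow>
        (LINT t:{0<..<T}|lborel. LINT x|torus d.
           - u t x * partial_t \<phi> t x
           + u t x powr m * (\<Sum>i<d. torus_conv d (K i) (u t) x * partial_x i (\<phi> t) x))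
        = (LINT x|torus d. u0 x * \<phi> 0 x))"

text \<open>
  Only the values of \<open>\<eta>\<close> and \<open>q\<close> on $[0,\infty)$ matter, since solutions are nonnegative.  For
  \<open>m < 1\<close> the derivative of \<open>q\<close> may blow up at 0, where \<open>q\<close> is merely continuous.
\<close>

definition entropy_pair :: "real \<Rightarrow> (real \<Rightarrow> real) \<Rightarrow> (real \<Rightarrow> real) \<Rightarrow> bool" where
  "entropy_pair m \<eta> q \<longleftrightarrow>
     convex_on UNIV \<eta> \<and>
     (\<forall>\<xi>. \<eta> differentiable (at \<xi>)) \<and>
     (\<forall>\<xi>. deriv \<eta> differentiable (at \<xi>)) \<and>
     continuous_on UNIV (deriv (deriv \<eta>)) \<and>
     continuous_on {0..} q \<and>
     (\<forall>\<xi>>0. (q has_real_derivative m * deriv \<eta> \<xi> * \<xi> powr (m - 1)) (at \<xi>))"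

definition entropy_inequality ::
  "nat \<Rightarrow> real \<Rightarrow> (nat \<Rightarrow> point \<Rightarrow> real) \<Rightarrow> (real \<Rightarrow> point \<Rightarrow> real) \<Rightarrow> bool" where
  "entropy_inequality d m K u \<longleftrightarrow>
     (\<forall>\<eta> q \<phi>. entropy_pair m \<eta> q \<and> test_nonneg d \<phi> \<longrightarrow>
        - (LINT t:{0<..}|lborel. LINT x|torus d. \<eta> (u t x) * partial_t \<phi> t x)
        \<le> - (LINT t:{0<..}|lborel. LINT x|torus d.
               q (u t x) * (\<Sum>i<d. torus_conv d (K i) (u t) x * partial_x i (\<phi> t) x))
          + (LINT t:{0<..}|lborel. LINT x|torus d.
               (q (u t x) - deriv \<eta> (u t x) * u t x powr m)
               * (u t x - torus_mean d (u t)) * \<phi> t x))"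

definition entropy_solution ::
  "nat \<Rightarrow> real \<Rightarrow> (nat \<Rightarrow> point \<Rightarrow> real) \<Rightarrow> (point \<Rightarrow> real) \<Rightarrow> (real \<Rightarrow> point \<Rightarrow> real) \<Rightarrow> bool" where
  "entropy_solution d m K u0 u \<longleftrightarrow>
     bounded_nonneg d u \<and> weak_formulation d m K u0 u \<and> entropy_inequality d m K u"

end

theory Submission
  imports Defs
begin

text \<open>
  Every estimate is obtained by testing the equation and the entropy inequality with functions of
  time alone. Their spatial gradient vanishes, so the transport terms disappear. The weak formulation
  then says that the spatial mean of \<open>u\<close> is the constant \<open>b\<close>, the mean of the initial datum
  (\<open>weak_formulation_mean\<close>, \<open>mean_constant\<close>). For a convex \<open>\<eta>\<close> of class $C^2$, with
  $H(\xi) = \int_0^\xi \eta''(s) s^m \, ds$, the entropy inequality becomes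
  $$\frac{d}{dt} \int \eta(u) \, dx \le - \int H(u) (u - b) \, dx$$
  in the sense of distributions (\<open>entropy_inequality_time\<close>). As \<open>u - b\<close> has mean zero, any constant
  may be subtracted from \<open>H(u)\<close>. Subtracting \<open>H(b)\<close> makes the integrand nonnegative, because \<open>H\<close> is
  nondecreasing; so all convex functionals of \<open>u\<close> decrease, and with them the $L^p$ norms.

  For the pointwise bounds the entropy moves with time. If \<open>\<Psi> t\<close> is a family of convex functions and
  $$\partial_t \Psi(t, \xi) + (a(t) - H_t(\xi)) (\xi - b) \le 0$$
  for some \<open>a(t)\<close>, then the integral of \<open>\<Psi> t (u t)\<close> is nonincreasing. This is applied to the cubes of
  the parts of \<open>u\<close> lying beyond a moving level \<open>c(t)\<close>.

  \<^item> For $\Psi(t, \xi) = (\xi - c(t))_+^3$ the condition reduces to $- c' \le c^m (c - b)$ with \<open>c \<ge> b\<close>.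
    The function $c(t) = b + (mt)^{-1/m}$ satisfies it. It blows up at time 0, so the integral is
    zero for small times, \<open>u\<close> being bounded, and hence always.

  \<^item> For $\Psi(t, \xi) = (c(t) - \xi)_+^3$ and \<open>m < 1\<close> it suffices that $3 c' \le c^m (b - c)$ with
    \<open>c \<le> b\<close>. As \<open>m < 1\<close>, this has a solution that leaves 0 at once, namely
    $c(t) = ((1 - m) b t / 6)^{1/(1-m)}$ as long as it is below \<open>b / 2\<close>. The integral is at most
    $c(t)^3$, which tends to 0 with \<open>t\<close>, so it vanishes again. At later times the level \<open>b / 2\<close> is kept,
    because levels below \<open>b\<close> are barriers as soon as they hold.

  Since \<open>u\<close> is only defined almost everywhere, monotonicity in time is proved for integrals over
  windows \<open>(t, t + h)\<close> (\<open>window_antimono\<close>): the window is a limit of smooth bumps translated to \<open>t\<close>, and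
  moving such a bump amounts to testing the entropy inequality with it. For the barriers such windows are
  enough. For the norms at a given time one passes to Lebesgue points, simultaneously for
  the countable family of entropies $(\xi^2 + \epsilon)^{q/2}$ and $(\xi - k)_+^3$ with rational
  parameters, from which all exponents are recovered by limits.
\<close>

section \<open>Smooth test functions depending on time only\<close>

text \<open>
  The recursion mirrors that of \<open>Ck\<close>, so that \<open>Ck_time\<close> below is a direct induction.
\<close>

fun smooth_upto :: "nat \<Rightarrow> (real \<Rightarrow> real) \<Rightarrow> bool" where
  "smooth_upto 0 f \<longleftrightarrow> continuous_on UNIV f"
| "smooth_upto (Suc k) f \<longleftrightarrow> (\<forall>x. f differentiable (at x)) \<and> smooth_upto k (deriv f)"

lemma smooth_upto_SucI:
  assumes "\<And>x. (f has_real_derivative f' x) (at x)" "smooth_upto k f'"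
  shows "smooth_upto (Suc k) f"
proof -
  have "deriv f = f'" using assms(1) by (intro ext DERIV_imp_deriv)
  thus ?thesis using assms by (auto simp: real_differentiable_def)
qed

lemma smooth_upto_SucE:
  assumes "smooth_upto (Suc k) f"
  shows "(f has_real_derivative deriv f x) (at x)" "smooth_upto k (deriv f)"
  using assms by (auto simp: DERIV_deriv_iff_real_differentiable)

lemma smooth_upto_Suc_imp: "smooth_upto (Suc k) f \<Longrightarrow> smooth_upto k f"
proof (induction k arbitrary: f)
  case 0
  have "isCont f x" for x using smooth_upto_SucE(1)[OF 0] by (rule DERIV_isCont)
  thus ?case by (simp add: continuous_on_eq_continuous_at)
next
  case (Suc k)
  show ?case
    using smooth_upto_SucE[OF Suc.prems] Suc.IH by (intro smooth_upto_SucI) auto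
qed

lemma smooth_upto_const: "smooth_upto k (\<lambda>_. c)"
proof (induction k arbitrary: c)
  case (Suc k)
  show ?case by (rule smooth_upto_SucI[OF _ Suc[of 0]]) simp
qed simp

lemma smooth_upto_add:
  "smooth_upto k f \<Longrightarrow> smooth_upto k g \<Longrightarrow> smooth_upto k (\<lambda>x. f x + g x)"
proof (induction k arbitrary: f g)
  case 0
  thus ?case by (simp add: continuous_on_add)
next
  case (Suc k)
  show ?case
    by (rule smooth_upto_SucI[OF DERIV_add Suc.IH])
       (use Suc.prems in \<open>auto dest: smooth_upto_SucE simp del: smooth_upto.simps\<close>)
qed

lemma smooth_upto_mult:
  "smooth_upto k f \<Longrightarrow> smooth_upto k g \<Longrightarrow> smooth_upto k (\<lambda>x. f x * g x)"
proof (induction k arbitrary: f g)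
  case 0
  thus ?case by (simp add: continuous_on_mult)
next
  case (Suc k)
  note f = smooth_upto_SucE[OF Suc.prems(1)] and g = smooth_upto_SucE[OF Suc.prems(2)]
  have "smooth_upto k (\<lambda>x. deriv f x * g x + deriv g x * f x)"
    by (intro smooth_upto_add Suc.IH f(2) g(2) smooth_upto_Suc_imp[OF Suc.prems(1)]
        smooth_upto_Suc_imp[OF Suc.prems(2)])
  thus ?case
    by (rule smooth_upto_SucI[OF DERIV_mult[OF f(1) g(1)]])
qed

lemma smooth_upto_affine: "smooth_upto k f \<Longrightarrow> smooth_upto k (\<lambda>x. f (a * x + b))"
proof (induction k arbitrary: f)
  case 0
  have "continuous_on UNIV (f \<circ> (\<lambda>x. a * x + b))"
    by (intro continuous_on_compose continuous_intros)
       (use 0 in \<open>auto intro: continuous_on_subset\<close>)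
  thus ?case by (simp add: o_def)
next
  case (Suc k)
  note f = smooth_upto_SucE[OF Suc.prems]
  show ?case
  proof (rule smooth_upto_SucI)
    show "((\<lambda>x. f (a * x + b)) has_real_derivative deriv f (a * x + b) * a) (at x)" for x
      by (rule DERIV_chain2[OF f(1)]) (auto intro!: derivative_eq_intros)
    show "smooth_upto k (\<lambda>x. deriv f (a * x + b) * a)"
      by (intro smooth_upto_mult smooth_upto_const Suc.IH f(2))
  qed
qed

text \<open>
  The family is closed under differentiation, as differentiating $p(1/x) e^{-1/x}$ only replaces \<open>p\<close>
  by $X^2 (p - p')$. Hence all derivatives of the flat function $e^{-1/x}$ are handled at once.
\<close>

definition flat_exp :: "real poly \<Rightarrow> real \<Rightarrow> real" where
  "flat_exp p x = (if x > 0 then poly p (1 / x) * exp (- 1 / x) else 0)"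

lemma flat_exp_tendsto_0: "((\<lambda>x. poly p (1 / x) * exp (- 1 / x)) \<longlongrightarrow> 0) (at_right (0::real))"
proof -
  have "((\<lambda>y. poly p y / exp y) \<longlongrightarrow> 0) at_top"
  proof -
    have "((\<lambda>y::real. \<Sum>i\<le>degree p. coeff p i * (y ^ i / exp y)) \<longlongrightarrow> (\<Sum>i\<le>degree p. coeff p i * 0)) at_top"
      by (intro tendsto_intros tendsto_power_div_exp_0)
    thus ?thesis by (simp add: poly_altdef sum_divide_distrib)
  qed
  hence "((\<lambda>x. poly p (inverse x) / exp (inverse x)) \<longlongrightarrow> 0) (at_right 0)"
    by (rule filterlim_compose[OF _ filterlim_inverse_at_top_right])
  thus ?thesis by (simp add: exp_minus field_simps)
qed

lemma flat_exp_has_derivative: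
  "(flat_exp p has_real_derivative flat_exp ([:0, 0, 1:] * (p - pderiv p)) x) (at x)"
proof (cases x "0::real" rule: linorder_cases)
  case less
  have "((\<lambda>x. 0) has_real_derivative 0) (at x)" by simp
  hence "(flat_exp p has_real_derivative 0) (at x)"
    by (rule DERIV_cong_ev[THEN iffD1, rotated -1])
       (use less in \<open>auto simp: flat_exp_def eventually_nhds intro!: exI[of _ "{..<0}"]\<close>)
  thus ?thesis using less by (simp add: flat_exp_def)
next
  case greater
  have "((\<lambda>x. poly p (1 / x) * exp (- 1 / x)) has_real_derivative
     poly ([:0, 0, 1:] * (p - pderiv p)) (1 / x) * exp (- 1 / x)) (at x)"
    using greater
    by (auto intro!: derivative_eq_intros DERIV_chain2[OF poly_DERIV] simp: field_simps power2_eq_square)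
  hence "(flat_exp p has_real_derivative poly ([:0, 0, 1:] * (p - pderiv p)) (1 / x) * exp (- 1 / x)) (at x)"
    by (rule DERIV_cong_ev[THEN iffD1, rotated -1])
       (use greater in \<open>auto simp: flat_exp_def eventually_nhds intro!: exI[of _ "{0<..}"]\<close>)
  thus ?thesis using greater by (simp add: flat_exp_def)
next
  case equal
  have "((\<lambda>h. flat_exp p h / h) \<longlongrightarrow> 0) (at 0)"
    unfolding at_eq_sup_left_right
  proof (rule filterlim_sup)
    show "((\<lambda>h. flat_exp p h / h) \<longlongrightarrow> 0) (at_left 0)"
      by (rule tendsto_eventually) (auto simp: flat_exp_def eventually_at_filter)
    have "((\<lambda>x. poly ([:0, 1:] * p) (1 / x) * exp (- 1 / x)) \<longlongrightarrow> 0) (at_right (0::real))"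
      by (rule flat_exp_tendsto_0)
    thus "((\<lambda>h. flat_exp p h / h) \<longlongrightarrow> 0) (at_right 0)"
      by (rule tendsto_cong[THEN iffD1, rotated])
         (auto simp: flat_exp_def eventually_at_filter)
  qed
  thus ?thesis using equal by (simp add: flat_exp_def DERIV_def)
qed

lemma smooth_upto_flat_exp: "smooth_upto k (flat_exp p)"
proof (induction k arbitrary: p)
  case 0
  have "isCont (flat_exp p) x" for x using flat_exp_has_derivative by (rule DERIV_isCont)
  thus ?case by (simp add: continuous_on_eq_continuous_at)
next
  case (Suc k)
  show ?case by (rule smooth_upto_SucI[OF flat_exp_has_derivative Suc.IH])
qed

text \<open>
  As \<open>l\<close> tends to 0 the product $e^{-l/s} e^{-l/(h-s)}$ increases to the indicator of \<open>(0, h)\<close>, so a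
  single family provides both the smooth test functions and the sharp window obtained from them.
\<close>

definition bump :: "real \<Rightarrow> real \<Rightarrow> real \<Rightarrow> real" where
  "bump l h s = flat_exp 1 (s / l) * flat_exp 1 ((h - s) / l)"

lemma smooth_upto_bump: "smooth_upto k (\<lambda>r. bump l h (r - t))"
proof -
  have "smooth_upto k (\<lambda>r. flat_exp 1 ((1/l) * r + (- t / l)) * flat_exp 1 ((- 1/l) * r + ((h + t) / l)))"
    by (intro smooth_upto_mult smooth_upto_affine smooth_upto_flat_exp)
  also have "(\<lambda>r. flat_exp 1 ((1/l) * r + (- t / l)) * flat_exp 1 ((- 1/l) * r + ((h + t) / l))) = (\<lambda>r. bump l h (r - t))"
    by (simp add: fun_eq_iff bump_def diff_divide_distrib add_divide_distrib algebra_simps)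
  finally show ?thesis .
qed

lemma flat_exp_1_bounds: "0 \<le> flat_exp 1 x" "flat_exp 1 x \<le> 1"
  by (auto simp: flat_exp_def)

lemma bump_bounds: "0 \<le> bump l h s" "bump l h s \<le> 1"
  unfolding bump_def using flat_exp_1_bounds by (auto intro: mult_le_one)

lemma bump_eq_0: "l > 0 \<Longrightarrow> s \<notin> {0<..<h} \<Longrightarrow> bump l h s = 0"
  by (auto simp: bump_def flat_exp_def zero_less_divide_iff)

lemma bump_tendsto_indicator:
  "((\<lambda>l. bump l h s) \<longlongrightarrow> indicator {0<..<h} s) (at_right 0)"
proof (cases "s \<in> {0<..<h}")
  case True
  have "((\<lambda>l. exp (- (l / s)) * exp (- (l / (h - s)))) \<longlongrightarrow> exp (- (0 / s)) * exp (- (0 / (h - s)))) (at_right 0)"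
    using True by (intro tendsto_intros) auto
  moreover have "\<forall>\<^sub>F l in at_right 0. exp (- (l / s)) * exp (- (l / (h - s))) = bump l h s"
    using True by (auto simp: eventually_at_filter bump_def flat_exp_def zero_less_divide_iff)
  ultimately show ?thesis using True by (simp add: tendsto_cong)
next
  case False
  thus ?thesis
    by (intro tendsto_eventually) (auto simp: eventually_at_filter bump_eq_0)
qed

text \<open>
  Test functions are only constrained for nonnegative times; a function on the whole line that agrees with
  them there determines the one-sided derivative.
\<close>

lemma partial_t_eq:
  assumes "\<And>t. t \<ge> 0 \<Longrightarrow> \<phi> t x = \<theta> t" "(\<theta> has_real_derivative D) (at t)" "t \<ge> 0"
  shows "((\<lambda>s. \<phi> s x) has_vector_derivative D) (at t within {0..})" "partial_t \<phi> t x = D"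
proof -
  have "(\<theta> has_vector_derivative D) (at t within {0..})"
    using assms(2) by (auto simp: has_real_derivative_iff_has_vector_derivative intro: has_vector_derivative_at_within)
  thus *: "((\<lambda>s. \<phi> s x) has_vector_derivative D) (at t within {0..})"
    by (rule has_vector_derivative_transform[rotated 2]) (use assms in auto)
  show "partial_t \<phi> t x = D"
    unfolding partial_t_def
  proof (rule vector_derivative_within[OF _ *])
    have "{t..t+1} \<subseteq> {0..}" using assms(3) by auto
    moreover have "at t within {t..t+1} \<noteq> bot" by (simp add: at_within_Icc_at_right trivial_limit_at_right_real)
    ultimately show "at t within {0..} \<noteq> bot"
      using at_le[of "{t..t+1}" "{0..}" t] by (auto simp: bot_unique)
  qed
qed

lemma Ck_time:
  assumes "smooth_upto k \<theta>" "\<And>t x. t \<ge> 0 \<Longrightarrow> x \<in> euclid d \<Longrightarrow> \<phi> t x = \<theta> t"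
  shows "Ck d k \<phi>"
  using assms
proof (induction k arbitrary: \<phi> \<theta>)
  case 0
  have "periodic d (\<phi> t)" if "t \<ge> 0" for t
    unfolding periodic_def
  proof (intro ballI allI impI)
    fix x i assume x: "x \<in> euclid d" and i: "i < d"
    hence "x(i := x i + 1) \<in> euclid d" by (auto simp: euclid_def PiE_iff extensional_def)
    thus "\<phi> t (x(i := x i + 1)) = \<phi> t x" using 0(2) that x by simp
  qed
  moreover have "continuous_on ({0..} \<times> euclid d) (\<lambda>(t, x). \<phi> t x)"
  proof -
    have "continuous_on ({0..} \<times> euclid d) (\<lambda>p. \<theta> (fst p))"
      using 0(1) by (auto intro!: continuous_intros intro: continuous_on_compose2)
    thus ?thesis
      by (rule continuous_on_cong[THEN iffD1, rotated -1]) (use 0(2) in auto)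
  qed
  ultimately show ?case by simp
next
  case (Suc k)
  note \<theta> = smooth_upto_SucE[OF Suc.prems(1)]
  have upd: "x(i := s) \<in> euclid d" if "x \<in> euclid d" "i < d" for x i s
    using that by (auto simp: euclid_def PiE_iff extensional_def)
  have const: "(\<lambda>s. \<phi> t (x(i := s))) = (\<lambda>_. \<theta> t)" if "t \<ge> 0" "x \<in> euclid d" "i < d" for t x i
    using Suc.prems(2)[OF that(1) upd[OF that(2,3)]] by (rule ext)
  have "Ck d k \<phi>" by (rule Suc.IH[OF smooth_upto_Suc_imp[OF Suc.prems(1)] Suc.prems(2)])
  hence "Ck d 0 \<phi>" by (cases k) auto
  moreover have "(\<lambda>s. \<phi> s x) differentiable (at t within {0..})" if "t \<ge> 0" "x \<in> euclid d" for t x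
    using partial_t_eq(1)[of \<phi> x \<theta>, OF _ \<theta>(1) that(1)] Suc.prems(2) that(2)
    by (auto intro: differentiableI_vector)
  moreover have "(\<lambda>s. \<phi> t (x(i := s))) differentiable (at (x i))" if "t \<ge> 0" "x \<in> euclid d" "i < d" for t x i
    unfolding const[OF that] by simp
  moreover have "Ck d k (partial_t \<phi>)"
    by (rule Suc.IH[OF \<theta>(2)], rule partial_t_eq(2)) (use \<theta>(1) Suc.prems(2) in auto)
  moreover have "Ck d k (\<lambda>t. partial_x i (\<phi> t))" if "i < d" for i
  proof (rule Suc.IH[OF smooth_upto_const])
    show "partial_x i (\<phi> t) x = 0" if "t \<ge> 0" "x \<in> euclid d" for t x
      unfolding partial_x_def const[OF that \<open>i < d\<close>] by simp
  qed
  ultimately show ?case by simp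
qed

section \<open>Calculus and measure theory on space-time\<close>

text \<open>
  By the mean value theorem the difference quotients are dominated by \<open>w\<close> as well.
\<close>

lemma has_derivative_under_integral:
  fixes F F' :: "real \<Rightarrow> 'a \<Rightarrow> real"
  assumes t: "a < t" "t < b"
    and int: "\<And>s. a < s \<Longrightarrow> s < b \<Longrightarrow> integrable M (F s)"
    and meas: "F' t \<in> borel_measurable M"
    and der: "\<And>s x. a < s \<Longrightarrow> s < b \<Longrightarrow> x \<in> space M \<Longrightarrow> ((\<lambda>s. F s x) has_real_derivative F' s x) (at s)"
    and bound: "\<And>s x. a < s \<Longrightarrow> s < b \<Longrightarrow> x \<in> space M \<Longrightarrow> \<bar>F' s x\<bar> \<le> w x"
    and w: "integrable M w"
  shows "((\<lambda>s. \<integral>x. F s x \<partial>M) has_real_derivative (\<integral>x. F' t x \<partial>M)) (at t)"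
proof -
  have "((\<lambda>s. ((\<integral>x. F s x \<partial>M) - (\<integral>x. F t x \<partial>M)) / (s - t)) \<longlongrightarrow> (\<integral>x. F' t x \<partial>M)) (at t)"
    unfolding tendsto_at_iff_sequentially o_def
  proof (intro allI impI)
    fix X :: "nat \<Rightarrow> real"
    assume X: "\<forall>i. X i \<in> UNIV - {t}" "X \<longlonglongrightarrow> t"
    hence "\<forall>\<^sub>F i in sequentially. X i \<in> {a<..<b}"
      using t by (intro topological_tendstoD) auto
    then obtain N where N: "\<And>i. i \<ge> N \<Longrightarrow> a < X i \<and> X i < b"
      by (auto simp: eventually_sequentially)
    have "(\<lambda>i. \<integral>x. (F (X (i + N)) x - F t x) / (X (i + N) - t) \<partial>M) \<longlonglongrightarrow> (\<integral>x. F' t x \<partial>M)"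
    proof (rule integral_dominated_convergence[OF meas _ w])
      show "(\<lambda>x. (F (X (i + N)) x - F t x) / (X (i + N) - t)) \<in> borel_measurable M" for i
        using int[of "X (i + N)"] int[of t] N[of "i + N"] t
        by (intro borel_measurable_divide borel_measurable_diff borel_measurable_const
            borel_measurable_integrable) auto
      show "AE x in M. (\<lambda>i. (F (X (i + N)) x - F t x) / (X (i + N) - t)) \<longlonglongrightarrow> F' t x"
      proof (rule AE_I2)
        fix x assume x: "x \<in> space M"
        have "((\<lambda>s. (F s x - F t x) / (s - t)) \<longlongrightarrow> F' t x) (at t)"
          using der[OF t x] by (simp add: has_field_derivative_iff)
        hence "(\<lambda>i. (F (X i) x - F t x) / (X i - t)) \<longlonglongrightarrow> F' t x"
          using X by (simp add: tendsto_at_iff_sequentially o_def)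
        thus "(\<lambda>i. (F (X (i + N)) x - F t x) / (X (i + N) - t)) \<longlonglongrightarrow> F' t x"
          by (rule LIMSEQ_ignore_initial_segment)
      qed
      show "AE x in M. norm ((F (X (i + N)) x - F t x) / (X (i + N) - t)) \<le> w x" for i
      proof (rule AE_I2)
        fix x assume x: "x \<in> space M"
        define s where "s = X (i + N)"
        have s: "a < s" "s < b" "s \<noteq> t" using N[of "i + N"] X by (auto simp: s_def)
        have "\<exists>z. a < z \<and> z < b \<and> F s x - F t x = (s - t) * F' z x"
        proof (cases "s < t")
          case True
          then obtain z where "z > s" "z < t" "F t x - F s x = (t - s) * F' z x"
            using MVT2[of s t "\<lambda>s. F s x" "\<lambda>s. F' s x"] der[OF _ _ x] s t by fastforce
          thus ?thesis using s t by (intro exI[of _ z]) (auto simp: algebra_simps)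
        next
          case False
          then obtain z where "z > t" "z < s" "F s x - F t x = (s - t) * F' z x"
            using MVT2[of t s "\<lambda>s. F s x" "\<lambda>s. F' s x"] der[OF _ _ x] s t by fastforce
          thus ?thesis using s t by (intro exI[of _ z]) auto
        qed
        then obtain z where z: "a < z" "z < b" "F s x - F t x = (s - t) * F' z x" by blast
        hence "(F s x - F t x) / (s - t) = F' z x" using s by simp
        thus "norm ((F (X (i + N)) x - F t x) / (X (i + N) - t)) \<le> w x"
          using bound[OF z(1,2) x] by (simp add: s_def)
      qed
    qed
    moreover have "(\<integral>x. (F (X (i + N)) x - F t x) / (X (i + N) - t) \<partial>M)
        = ((\<integral>x. F (X (i + N)) x \<partial>M) - (\<integral>x. F t x \<partial>M)) / (X (i + N) - t)" for i
      using int[of "X (i + N)"] int[of t] N[of "i + N"] t by simp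
    ultimately have "(\<lambda>i. ((\<integral>x. F (X (i + N)) x \<partial>M) - (\<integral>x. F t x \<partial>M)) / (X (i + N) - t)) \<longlonglongrightarrow> (\<integral>x. F' t x \<partial>M)"
      by (simp only:)
    thus "(\<lambda>i. ((\<integral>x. F (X i) x \<partial>M) - (\<integral>x. F t x \<partial>M)) / (X i - t)) \<longlonglongrightarrow> (\<integral>x. F' t x \<partial>M)"
      by (rule LIMSEQ_offset)
  qed
  thus ?thesis by (simp add: has_field_derivative_iff)
qed

text \<open>
  A form of the Lebesgue differentiation theorem, with open windows to the right of the point.
\<close>

lemma lebesgue_right_average:
  fixes e :: "real \<Rightarrow> real"
  assumes [measurable]: "e \<in> borel_measurable borel" and B: "\<And>t. \<bar>e t\<bar> \<le> B"
  shows "AE t in lborel. ((\<lambda>h. (LINT r:{t<..<t+h}|lborel. e r) / h) \<longlongrightarrow> e t) (at_right 0)"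
proof -
  have si: "set_integrable lborel S e" if "S \<in> sets borel" "emeasure lborel S < \<infinity>" for S
    unfolding set_integrable_def
    by (rule integrableI_bounded_set_indicator[where B = B]) (use that B in auto)
  have int: "e integrable_on cbox a b" for a b
    by (rule set_borel_integral_eq_integral(1)[OF si]) (auto simp: emeasure_lborel_Icc_eq)
  from integrable_ccontinuous_explicit[OF int] obtain N where N: "negligible N"
    "\<And>x \<epsilon>. x \<notin> N \<Longrightarrow> 0 < \<epsilon> \<Longrightarrow> \<exists>d>0. \<forall>h. 0 < h \<and> h < d \<longrightarrow>
        norm (integral (cbox x (x + h *\<^sub>R One)) e /\<^sub>R h ^ DIM(real) - e x) < \<epsilon>" by metis
  have "N \<in> null_sets (completion lborel)"
    using N(1) by (simp add: negligible_iff_null_sets)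
  then obtain N' where N': "N' \<in> null_sets lborel" "N \<subseteq> N'"
    by (auto simp: null_sets_completion_iff2)
  show ?thesis
  proof (rule AE_I'[OF N'(1)], rule subsetI, rule ccontr)
    fix t assume *: "t \<in> {t \<in> space lborel. \<not> ((\<lambda>h. (LINT r:{t<..<t+h}|lborel. e r) / h) \<longlongrightarrow> e t) (at_right 0)}" "t \<notin> N'"
    have "((\<lambda>h. (LINT r:{t<..<t+h}|lborel. e r) / h) \<longlongrightarrow> e t) (at_right 0)"
    proof (rule tendstoI)
      fix \<epsilon> :: real assume "\<epsilon> > 0"
      then obtain d where d: "d > 0" "\<And>h. 0 < h \<Longrightarrow> h < d \<Longrightarrow>
          norm (integral (cbox t (t + h *\<^sub>R One)) e /\<^sub>R h ^ DIM(real) - e t) < \<epsilon>"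
        using N(2)[of t \<epsilon>] * N'(2) by blast
      have eq: "(LINT r:{t<..<t+h}|lborel. e r) = integral {t..t+h} e" for h
        by (subst set_borel_integral_eq_integral(2)[OF si]) (cases "h \<ge> 0"; auto simp: integral_open_interval_real)+
      show "\<forall>\<^sub>F h in at_right 0. dist ((LINT r:{t<..<t+h}|lborel. e r) / h) (e t) < \<epsilon>"
        unfolding eventually_at_right_field eq
        using d by (intro exI[of _ d]) (auto simp: dist_norm divide_inverse_commute)
    qed
    thus False using * by simp
  qed
qed

lemma prob_space_torus: "prob_space (torus d)"
  unfolding torus_def by (intro prob_space_PiM prob_space_restrict_space) auto

lemma pair_sigma_finite_spacetime: "pair_sigma_finite (restrict_space (lborel :: real measure) {0<..}) (torus d)"
proof -
  interpret prob_space "torus d" by (rule prob_space_torus)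
  have "{0<..} \<in> sets (lborel :: real measure)" by simp
  thus ?thesis
    by (intro pair_sigma_finite.intro sigma_finite_measure_restrict_space)
       (auto intro: lborel.sigma_finite_measure_axioms sigma_finite_measure_axioms)
qed

lemma measurable_time [measurable]: "fst \<in> borel_measurable (spacetime d)"
proof -
  have "id \<in> borel_measurable (restrict_space lborel {0<..} :: real measure)"
    by (intro measurable_restrict_space1) simp
  from measurable_compose[OF measurable_fst this] show ?thesis
    by (simp add: spacetime_def)
qed

lemma space_spacetime: "z \<in> space (spacetime d) \<longleftrightarrow> fst z > 0 \<and> snd z \<in> space (torus d)"
  by (cases z) (auto simp: spacetime_def space_pair_measure space_restrict_space)

lemma AE_spacetime_D:
  assumes "AE z in spacetime d. P z"
  shows "AE t in lborel. t > 0 \<longrightarrow> (AE x in torus d. P (t, x))"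
proof -
  interpret pair_sigma_finite "restrict_space (lborel :: real measure) {0<..}" "torus d"
    by (rule pair_sigma_finite_spacetime)
  from AE_pair[OF assms[unfolded spacetime_def]] show ?thesis
    by (subst (asm) AE_restrict_space_iff) auto
qed

lemma AE_spacetime_I:
  assumes "AE t in lborel. t > 0 \<longrightarrow> (AE x in torus d. P (t, x))"
    and "{z \<in> space (spacetime d). P z} \<in> sets (spacetime d)"
  shows "AE z in spacetime d. P z"
proof -
  interpret pair_sigma_finite "restrict_space (lborel :: real measure) {0<..}" "torus d"
    by (rule pair_sigma_finite_spacetime)
  show ?thesis
    using assms unfolding spacetime_def
    by (intro AE_pair_measure) (auto simp: AE_restrict_space_iff)
qed

lemma integrable_spacetime_indicator:
  "integrable (spacetime d) (\<lambda>z. (B::real) * indicator {..R} (fst z))"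
proof -
  interpret P: pair_sigma_finite "restrict_space (lborel :: real measure) {0<..}" "torus d"
    by (rule pair_sigma_finite_spacetime)
  interpret Q: prob_space "torus d" by (rule prob_space_torus)
  have "emeasure (spacetime d) ({0<..R} \<times> space (torus d)) = emeasure lborel {0<..R} * 1"
  proof -
    have "{0<..R} \<in> sets (restrict_space lborel {0<..})"
      by (subst sets_restrict_space_iff) auto
    thus ?thesis
      unfolding spacetime_def
      by (subst P.M2.emeasure_pair_measure_Times)
         (auto simp: Q.emeasure_space_1 intro!: emeasure_restrict_space)
  qed
  moreover have "{z \<in> space (spacetime d). fst z \<le> R} = {0<..R} \<times> space (torus d)"
    by (auto simp: space_spacetime)
  moreover have "{z \<in> space (spacetime d). fst z \<le> R} \<in> sets (spacetime d)" by measurable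
  moreover have fin: "emeasure lborel {0<..R} < \<infinity>"
    using emeasure_lborel_Ioc[of 0 R] by (cases "R \<ge> 0") simp_all
  ultimately have "integrable (spacetime d) (indicator {z \<in> space (spacetime d). fst z \<le> R} :: _ \<Rightarrow> real)"
    using fin by (intro integrable_real_indicator) simp_all
  hence "integrable (spacetime d) (\<lambda>z. B * indicator {z \<in> space (spacetime d). fst z \<le> R} z)" by simp
  thus ?thesis
    by (rule Bochner_Integration.integrable_cong[THEN iffD1, rotated -1]) (auto simp: indicator_def)
qed

lemma integrable_spacetime:
  fixes f :: "real \<times> point \<Rightarrow> real"
  assumes "f \<in> borel_measurable (spacetime d)" "\<And>z. z \<in> space (spacetime d) \<Longrightarrow> \<bar>f z\<bar> \<le> B * indicator {..R} (fst z)"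
  shows "integrable (spacetime d) f"
  by (rule Bochner_Integration.integrable_bound[OF integrable_spacetime_indicator[of d B R] assms(1)])
     (auto intro!: AE_I2 order_trans[OF assms(2)])

lemma iterated_integral_spacetime:
  fixes f :: "real \<Rightarrow> point \<Rightarrow> real" and g :: "real \<times> point \<Rightarrow> real"
  assumes "(\<lambda>(t, x). f t x) \<in> borel_measurable (spacetime d)" "integrable (spacetime d) g"
    and "AE z in spacetime d. f (fst z) (snd z) = g z"
  shows "(LINT t:{0<..}|lborel. LINT x|torus d. f t x) = (\<integral>z. g z \<partial>spacetime d)"
proof -
  interpret P: pair_sigma_finite "restrict_space (lborel :: real measure) {0<..}" "torus d"
    by (rule pair_sigma_finite_spacetime)
  have eq: "AE z in spacetime d. (\<lambda>(t, x). f t x) z = g z"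
    using assms(3) by (simp add: case_prod_unfold)
  have "integrable (spacetime d) (\<lambda>(t, x). f t x)"
    using assms(2) by (subst integrable_cong_AE[OF assms(1) _ eq]) auto
  from P.integral_fst'[OF this[unfolded spacetime_def]]
  have "(LINT t|restrict_space lborel {0<..}. LINT x|torus d. f t x) = (\<integral>z. (\<lambda>(t, x). f t x) z \<partial>spacetime d)"
    by (simp add: spacetime_def)
  also have "\<dots> = (\<integral>z. g z \<partial>spacetime d)"
    using assms(1,2) eq by (intro integral_cong_AE) auto
  finally show ?thesis
    by (simp add: set_lebesgue_integral_def integral_restrict_space)
qed

lemma AE_time_neq: "AE z in spacetime d. fst z \<noteq> c"
proof (rule AE_spacetime_I)
  have "AE t in lborel. t \<noteq> c" by (rule AE_lborel_singleton)
  thus "AE t in lborel. t > 0 \<longrightarrow> (AE x in torus d. fst (t, x) \<noteq> c)" by auto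
qed measurable

text \<open>
  The spatial integral as a function on the whole line, so that integrals over time windows are ordinary
  Lebesgue integrals of it.
\<close>

definition slice :: "nat \<Rightarrow> (real \<times> point \<Rightarrow> real) \<Rightarrow> real \<Rightarrow> real" where
  "slice d f t = indicator {0<..} t * (LINT x|torus d. f (t, x))"

lemma measurable_slice [measurable]:
  assumes "f \<in> borel_measurable (spacetime d)"
  shows "slice d f \<in> borel_measurable borel"
proof -
  interpret P: pair_sigma_finite "restrict_space (lborel :: real measure) {0<..}" "torus d"
    by (rule pair_sigma_finite_spacetime)
  have "(\<lambda>t. LINT x|torus d. f (t, x)) \<in> borel_measurable (restrict_space lborel {0<..})"
    using assms by (intro P.M2.borel_measurable_lebesgue_integral) (simp add: spacetime_def)
  hence "(\<lambda>t. indicator {0<..} t *\<^sub>R (LINT x|torus d. f (t, x))) \<in> borel_measurable lborel"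
    by (subst (asm) borel_measurable_restrict_space_iff) auto
  thus ?thesis by (simp add: slice_def[abs_def])
qed

lemma measurable_section:
  assumes "f \<in> borel_measurable (spacetime d)" "t > 0"
  shows "(\<lambda>x. f (t, x)) \<in> borel_measurable (torus d)"
proof -
  have "t \<in> space (restrict_space lborel {0<..})" using assms by (simp add: space_restrict_space)
  from measurable_Pair2[OF assms(1)[unfolded spacetime_def] this] show ?thesis .
qed

lemma slice_bound:
  assumes "f \<in> borel_measurable (spacetime d)" "\<And>z. z \<in> space (spacetime d) \<Longrightarrow> \<bar>f z\<bar> \<le> B" "B \<ge> 0"
  shows "\<bar>slice d f t\<bar> \<le> B"
proof (cases "t > 0")
  case True
  interpret prob_space "torus d" by (rule prob_space_torus)
  have bd: "\<bar>f (t, x)\<bar> \<le> B" if "x \<in> space (torus d)" for x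
    using assms(2)[of "(t, x)"] that True by (simp add: space_spacetime)
  have int: "integrable (torus d) (\<lambda>x. f (t, x))"
    by (rule integrable_const_bound[of _ B]) (use bd measurable_section[OF assms(1) True] in auto)
  have "\<bar>LINT x|torus d. f (t, x)\<bar> \<le> (LINT x|torus d. \<bar>f (t, x)\<bar>)" by (rule integral_abs_bound)
  also have "\<dots> \<le> (LINT x|torus d. B)" using int bd by (intro integral_mono) auto
  finally show ?thesis using True by (simp add: slice_def prob_space)
qed (use assms in \<open>simp add: slice_def\<close>)

lemma integral_window:
  assumes [measurable]: "f \<in> borel_measurable (spacetime d)"
    and B: "\<And>z. z \<in> space (spacetime d) \<Longrightarrow> \<bar>f z\<bar> \<le> B"
  shows "integrable (spacetime d) (\<lambda>z. indicator {a<..<c} (fst z) * f z)"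
    and "(LINT r:{a<..<c}|lborel. slice d f r) = (\<integral>z. indicator {a<..<c} (fst z) * f z \<partial>spacetime d)"
proof -
  show int: "integrable (spacetime d) (\<lambda>z. indicator {a<..<c} (fst z) * f z)"
    by (rule integrable_spacetime[where B = B and R = c])
       (use B in \<open>auto simp: indicator_def intro: order_trans[OF abs_ge_zero]\<close>)
  have "(LINT t:{0<..}|lborel. LINT x|torus d. indicator {a<..<c} t * f (t, x))
      = (\<integral>z. indicator {a<..<c} (fst z) * f z \<partial>spacetime d)"
    by (rule iterated_integral_spacetime[OF _ int]) (simp_all add: case_prod_unfold)
  thus "(LINT r:{a<..<c}|lborel. slice d f r) = (\<integral>z. indicator {a<..<c} (fst z) * f z \<partial>spacetime d)"
    by (simp add: set_lebesgue_integral_def slice_def mult_ac)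
qed

lemma continuous_on_compact_bound:
  fixes f :: "'a::metric_space \<Rightarrow> real"
  assumes "continuous_on A f" "compact K" "K \<subseteq> A"
  obtains B where "B \<ge> 0" "\<And>x. x \<in> K \<Longrightarrow> \<bar>f x\<bar> \<le> B"
proof -
  have "compact (f ` K)"
    using assms by (intro compact_continuous_image continuous_on_subset[OF assms(1)])
  from compact_imp_bounded[OF this] obtain B where "B > 0" "\<forall>x\<in>K. \<bar>f x\<bar> \<le> B"
    unfolding bounded_pos by auto
  thus ?thesis using that[of B] by simp
qed

lemma continuous_on_section:
  assumes "continuous_on (A \<times> UNIV) (\<lambda>(t, \<xi>). f t \<xi>)" "t \<in> A"
  shows "continuous_on UNIV (f t)"
proof -
  have "continuous_on UNIV (\<lambda>\<xi>. (\<lambda>(t, \<xi>). f t \<xi>) (t, \<xi>))"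
    by (rule continuous_on_compose2[OF assms(1)]) (use assms(2) in \<open>auto intro!: continuous_intros\<close>)
  thus ?thesis by simp
qed

section \<open>Convex entropies and their dissipation\<close>

text \<open>
  The exponent is at least 2, so the one-sided slopes at 0 agree.
\<close>

lemma pos_part_power_has_derivative:
  "((\<lambda>x::real. max 0 x ^ Suc (Suc n)) has_real_derivative real (n + 2) * max 0 x ^ Suc n) (at x)"
proof (cases x "0::real" rule: linorder_cases)
  case less
  have "((\<lambda>x. 0) has_real_derivative 0) (at x)" by simp
  hence "((\<lambda>x. max 0 x ^ Suc (Suc n)) has_real_derivative 0) (at x)"
    by (rule DERIV_cong_ev[THEN iffD1, rotated -1])
       (use less in \<open>auto simp: eventually_nhds intro!: exI[of _ "{..<0}"]\<close>)
  thus ?thesis using less by (simp add: max_def)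
next
  case greater
  have "((\<lambda>x. x ^ Suc (Suc n)) has_real_derivative real (n + 2) * x ^ Suc n) (at x)"
    by (rule derivative_eq_intros | simp)+
  hence "((\<lambda>x. max 0 x ^ Suc (Suc n)) has_real_derivative real (n + 2) * x ^ Suc n) (at x)"
    by (rule DERIV_cong_ev[THEN iffD1, rotated -1])
       (use greater in \<open>auto simp: eventually_nhds max_def intro!: exI[of _ "{0<..}"]\<close>)
  thus ?thesis using greater by (simp add: max_def)
next
  case equal
  have "((\<lambda>h::real. max 0 h ^ Suc n) \<longlongrightarrow> max 0 0 ^ Suc n) (at 0)"
    by (intro tendsto_intros)
  hence "((\<lambda>h::real. max 0 h ^ Suc n) \<longlongrightarrow> 0) (at 0)" by simp
  hence "((\<lambda>h::real. max 0 h ^ Suc (Suc n) / h) \<longlongrightarrow> 0) (at 0)"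
    by (rule Lim_transform_eventually)
       (auto simp: eventually_at_filter max_def)
  thus ?thesis using equal by (simp add: DERIV_def)
qed

text \<open>
  The first two derivatives are carried as parameters, so that the dissipation of a concrete entropy is
  written with its second derivative in closed form.
\<close>

definition C2_convex :: "(real \<Rightarrow> real) \<Rightarrow> (real \<Rightarrow> real) \<Rightarrow> (real \<Rightarrow> real) \<Rightarrow> bool" where
  "C2_convex \<eta> \<eta>' \<eta>'' \<longleftrightarrow>
     (\<forall>\<xi>. (\<eta> has_real_derivative \<eta>' \<xi>) (at \<xi>)) \<and>
     (\<forall>\<xi>. (\<eta>' has_real_derivative \<eta>'' \<xi>) (at \<xi>)) \<and>
     continuous_on UNIV \<eta>'' \<and> (\<forall>\<xi>. 0 \<le> \<eta>'' \<xi>)"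

lemma C2_convex_continuous:
  assumes "C2_convex \<eta> \<eta>' \<eta>''"
  shows "continuous_on UNIV \<eta>" "continuous_on UNIV \<eta>'"
  using assms DERIV_isCont unfolding C2_convex_def
  by (fastforce simp: continuous_on_eq_continuous_at)+

text \<open>
  This is $H(\xi) = \int_0^\xi \eta''(s) s^m \, ds$ for \<open>w\<close> equal to $\eta''$. The
  spatial integral of \<open>\<eta> u\<close> decays at least at the rate given by the integral of \<open>H(u) (u - b)\<close>.
\<close>

definition dissip :: "real \<Rightarrow> (real \<Rightarrow> real) \<Rightarrow> real \<Rightarrow> real" where
  "dissip m w \<xi> = integral {0..\<xi>} (\<lambda>s. w s * s powr m)"

lemma continuous_on_weight:
  assumes "m > 0" "continuous_on UNIV w"
  shows "continuous_on {0..y} (\<lambda>s. w s * s powr m :: real)"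
  using assms(1) by (intro continuous_intros continuous_on_powr' continuous_on_subset[OF assms(2)]) auto

lemma dissip_diff:
  assumes "m > 0" "continuous_on UNIV w" "0 \<le> x" "x \<le> y"
  shows "dissip m w y - dissip m w x = integral {x..y} (\<lambda>s. w s * s powr m)"
  using Henstock_Kurzweil_Integration.integral_combine[OF assms(3,4)
    integrable_continuous_interval[OF continuous_on_weight[OF assms(1,2)]]]
  by (simp add: dissip_def)

lemma dissip_mono:
  assumes m: "m > 0" and "continuous_on UNIV w" "\<And>\<xi>. 0 \<le> w \<xi>" "0 \<le> x" "x \<le> y"
  shows "dissip m w x \<le> dissip m w y"
proof -
  have "0 \<le> integral {x..y} (\<lambda>s. w s * s powr m)"
    using assms
    by (intro integral_nonneg integrable_continuous_interval
          continuous_on_subset[OF continuous_on_weight[OF m assms(2), of y]]) auto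
  thus ?thesis using dissip_diff[OF m assms(2,4,5)] by simp
qed

lemma dissip_has_derivative:
  assumes "m > 0" "continuous_on UNIV w" "\<xi> > 0"
  shows "(dissip m w has_real_derivative w \<xi> * \<xi> powr m) (at \<xi>)"
proof -
  have "((\<lambda>x. integral {0..x} (\<lambda>s. w s * s powr m)) has_real_derivative w \<xi> * \<xi> powr m) (at \<xi> within {0..\<xi> + 1})"
    by (rule integral_has_real_derivative[OF continuous_on_weight]) (use assms in auto)
  moreover have "at \<xi> within {0..\<xi> + 1} = at \<xi>"
    using assms by (intro at_within_interior) auto
  ultimately show ?thesis by (simp add: dissip_def[abs_def])
qed

text \<open>
  Continuity holds on the whole line because the interval of integration is empty for negative arguments.
\<close>

lemma continuous_on_dissip:
  assumes "m > 0" "continuous_on UNIV w"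
  shows "continuous_on UNIV (dissip m w)"
proof -
  have 1: "continuous_on {0..y} (dissip m w)" for y
    unfolding dissip_def[abs_def]
    by (intro indefinite_integral_continuous_1 integrable_continuous_interval continuous_on_weight assms)
  have 2: "continuous_on {0..} (dissip m w)"
    unfolding continuous_on_eq_continuous_within
  proof
    fix x :: real assume "x \<in> {0..}"
    hence "continuous (at x within {0..x+1}) (dissip m w)"
      using 1[of "x + 1"] by (auto simp: continuous_on_eq_continuous_within)
    moreover have "at x within {0..x+1} = at x within {0..}"
      by (rule at_within_nhd[of _ "{x-1<..<x+1}"]) auto
    ultimately show "continuous (at x within {0..}) (dissip m w)"
      by (simp add: continuous_within)
  qed
  have "continuous_on UNIV (\<lambda>x. dissip m w (max 0 x))"
    by (rule continuous_on_compose2[OF 2]) (auto intro!: continuous_intros)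
  moreover have "dissip m w (max 0 x) = dissip m w x" for x
    by (auto simp: dissip_def max_def)
  ultimately show ?thesis by simp
qed

text \<open>
  Integrating $q' = m \eta' \xi^{m-1}$ by parts gives $q = \eta' \xi^m - H$. With this choice of the
  constant of integration the source term $q - \eta' \xi^m$ of the entropy inequality is exactly \<open>- H\<close>.
\<close>

lemma entropy_pair_dissip:
  assumes "m > 0" "C2_convex \<eta> \<eta>' \<eta>''"
  shows "entropy_pair m \<eta> (\<lambda>\<xi>. \<eta>' \<xi> * \<xi> powr m - dissip m \<eta>'' \<xi>)" "deriv \<eta> = \<eta>'"
proof -
  note * = assms(2)[unfolded C2_convex_def]
  show d1: "deriv \<eta> = \<eta>'" using * by (intro ext DERIV_imp_deriv) auto
  have d2: "deriv \<eta>' = \<eta>''" using * by (intro ext DERIV_imp_deriv) auto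
  have "convex_on UNIV \<eta>"
    by (rule f''_ge0_imp_convex[where f' = \<eta>' and f'' = \<eta>'']) (use * in auto)
  moreover have "continuous_on {0..} \<eta>'"
    using C2_convex_continuous(2)[OF assms(2)] by (rule continuous_on_subset) auto
  hence "continuous_on {0..} (\<lambda>\<xi>. \<eta>' \<xi> * \<xi> powr m - dissip m \<eta>'' \<xi>)"
    using * assms(1)
    by (intro continuous_intros continuous_on_powr' continuous_on_subset[OF continuous_on_dissip]) auto
  moreover have "((\<lambda>\<xi>. \<eta>' \<xi> * \<xi> powr m - dissip m \<eta>'' \<xi>) has_real_derivative m * \<eta>' \<xi> * \<xi> powr (m - 1)) (at \<xi>)"
    if "\<xi> > 0" for \<xi>
    by (rule derivative_eq_intros dissip_has_derivative | use * assms(1) that in \<open>force simp: algebra_simps\<close>)+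
  ultimately show "entropy_pair m \<eta> (\<lambda>\<xi>. \<eta>' \<xi> * \<xi> powr m - dissip m \<eta>'' \<xi>)"
    unfolding entropy_pair_def d1 d2 using * by (auto simp: real_differentiable_def)
qed

lemma C2_convex_upper:
  "C2_convex (\<lambda>\<xi>. max 0 (\<xi> - c) ^ 3) (\<lambda>\<xi>. 3 * (max 0 (\<xi> - c))\<^sup>2) (\<lambda>\<xi>. 6 * max 0 (\<xi> - c))"
proof -
  have "((\<lambda>\<xi>. max 0 (\<xi> - c) ^ 3) has_real_derivative 3 * (max 0 (\<xi> - c))\<^sup>2) (at \<xi>)" for \<xi>
    using DERIV_shift[of "\<lambda>x. max 0 x ^ Suc (Suc 1)" _ \<xi> "- c"] pos_part_power_has_derivative[of 1 "\<xi> - c"]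
    by (simp add: eval_nat_numeral)
  moreover have "((\<lambda>\<xi>. 3 * (max 0 (\<xi> - c))\<^sup>2) has_real_derivative 6 * max 0 (\<xi> - c)) (at \<xi>)" for \<xi>
  proof -
    have "((\<lambda>\<xi>. (max 0 (\<xi> - c))\<^sup>2) has_real_derivative 2 * max 0 (\<xi> - c)) (at \<xi>)"
      using DERIV_shift[of "\<lambda>x. max 0 x ^ Suc (Suc 0)" _ \<xi> "- c"] pos_part_power_has_derivative[of 0 "\<xi> - c"]
      by (simp add: eval_nat_numeral)
    from DERIV_cmult[OF this, of 3] show ?thesis by simp
  qed
  ultimately show ?thesis
    unfolding C2_convex_def by (auto intro!: continuous_intros)
qed

lemma C2_convex_lower:
  "C2_convex (\<lambda>\<xi>. max 0 (c - \<xi>) ^ 3) (\<lambda>\<xi>. - 3 * (max 0 (c - \<xi>))\<^sup>2) (\<lambda>\<xi>. 6 * max 0 (c - \<xi>))"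
proof -
  have m: "((\<lambda>\<xi>. c - \<xi>) has_real_derivative - 1) (at \<xi>)" for \<xi>
    by (auto intro!: derivative_eq_intros)
  have 3: "((\<lambda>x::real. max 0 x ^ 3) has_real_derivative 3 * (max 0 y)\<^sup>2) (at y)" for y
    using pos_part_power_has_derivative[of 1 y] by (simp add: eval_nat_numeral)
  have 2: "((\<lambda>x::real. - 3 * (max 0 x)\<^sup>2) has_real_derivative - 6 * max 0 y) (at y)" for y
    using DERIV_cmult[OF pos_part_power_has_derivative[of 0 y], of "- 3"] by (simp add: eval_nat_numeral)
  show ?thesis
    unfolding C2_convex_def
    using DERIV_chain2[OF 3 m] DERIV_chain2[OF 2 m] by (auto intro!: continuous_intros)
qed

text \<open>
  Only \<open>s \<ge> c\<close> contributes to the integral, and there $s^m \ge c^m$. The first bound compares \<open>H\<close>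
  with $c^m \eta'$.
\<close>

lemma dissip_upper:
  assumes "m > 0" "c \<ge> 0" "\<xi> \<ge> 0"
  shows "c powr m * (3 * (max 0 (\<xi> - c))\<^sup>2) \<le> dissip m (\<lambda>\<xi>. 6 * max 0 (\<xi> - c)) \<xi>"
    and "\<xi> \<le> c \<Longrightarrow> dissip m (\<lambda>\<xi>. 6 * max 0 (\<xi> - c)) \<xi> = 0"
proof -
  have cont: "continuous_on UNIV (\<lambda>\<xi>. 6 * max 0 (\<xi> - c))" by (intro continuous_intros)
  have "((\<lambda>s. c powr m * (6 * max 0 (s - c))) has_integral
      c powr m * (3 * (max 0 (\<xi> - c))\<^sup>2) - c powr m * (3 * (max 0 (0 - c))\<^sup>2)) {0..\<xi>}"
  proof (rule fundamental_theorem_of_calculus[OF assms(3)])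
    fix x
    from C2_convex_upper have "((\<lambda>\<xi>. 3 * (max 0 (\<xi> - c))\<^sup>2) has_real_derivative 6 * max 0 (x - c)) (at x)"
      unfolding C2_convex_def by blast
    from DERIV_cmult[OF this, of "c powr m"]
    show "((\<lambda>x. c powr m * (3 * (max 0 (x - c))\<^sup>2)) has_vector_derivative c powr m * (6 * max 0 (x - c))) (at x within {0..\<xi>})"
      by (simp add: has_real_derivative_iff_has_vector_derivative[symmetric] has_field_derivative_at_within)
  qed
  hence "((\<lambda>s. c powr m * (6 * max 0 (s - c))) has_integral c powr m * (3 * (max 0 (\<xi> - c))\<^sup>2)) {0..\<xi>}"
    using assms(2) by simp
  moreover have "((\<lambda>s. 6 * max 0 (s - c) * s powr m) has_integral dissip m (\<lambda>\<xi>. 6 * max 0 (\<xi> - c)) \<xi>) {0..\<xi>}"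
    unfolding dissip_def
    by (intro integrable_integral integrable_continuous_interval continuous_on_weight cont assms(1))
  ultimately show "c powr m * (3 * (max 0 (\<xi> - c))\<^sup>2) \<le> dissip m (\<lambda>\<xi>. 6 * max 0 (\<xi> - c)) \<xi>"
  proof (rule has_integral_le)
    fix s assume "s \<in> {0..\<xi>}"
    show "c powr m * (6 * max 0 (s - c)) \<le> 6 * max 0 (s - c) * s powr m"
    proof (cases "s \<le> c")
      case False
      hence "c powr m \<le> s powr m" using assms by (intro powr_mono2) auto
      thus ?thesis by (subst mult.commute) (intro mult_left_mono, auto)
    qed simp
  qed
  show "dissip m (\<lambda>\<xi>. 6 * max 0 (\<xi> - c)) \<xi> = 0" if "\<xi> \<le> c"
    unfolding dissip_def
    by (rule integral_unique, rule has_integral_is_0) (use that in auto)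
qed

text \<open>
  On \<open>[0, c]\<close> the concave power $s^m$ lies above its chord $c^{m-1} s$, and the integral of
  $6 (c - s) s$ from \<open>\<xi>\<close> to \<open>c\<close> is $(c - \xi)^2 (c + 2 \xi)$. This keeps the factor $c^m$ even
  when \<open>\<xi>\<close> is 0, where the weight itself vanishes.
\<close>

lemma dissip_lower:
  assumes "0 < m" "m < 1" "c > 0" "\<xi> \<ge> 0"
  shows "\<xi> \<le> c \<Longrightarrow> c powr m * (c - \<xi>)\<^sup>2
      \<le> dissip m (\<lambda>\<xi>. 6 * max 0 (c - \<xi>)) c - dissip m (\<lambda>\<xi>. 6 * max 0 (c - \<xi>)) \<xi>"
    and "c \<le> \<xi> \<Longrightarrow> dissip m (\<lambda>\<xi>. 6 * max 0 (c - \<xi>)) \<xi> = dissip m (\<lambda>\<xi>. 6 * max 0 (c - \<xi>)) c"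
proof -
  have cont: "continuous_on UNIV (\<lambda>\<xi>. 6 * max 0 (c - \<xi>))" by (intro continuous_intros)
  have int: "(\<lambda>s. 6 * max 0 (c - s) * s powr m) integrable_on {x..y}" if "0 \<le> x" for x y
    by (intro integrable_continuous_interval continuous_on_subset[OF continuous_on_weight[OF assms(1) cont, of y]])
       (use that in auto)
  show "c powr m * (c - \<xi>)\<^sup>2 \<le> dissip m (\<lambda>\<xi>. 6 * max 0 (c - \<xi>)) c - dissip m (\<lambda>\<xi>. 6 * max 0 (c - \<xi>)) \<xi>"
    if "\<xi> \<le> c"
  proof -
    define G where "G = (\<lambda>s. c powr (m - 1) * (3 * c * s\<^sup>2 - 2 * s ^ 3))"
    have "c powr m * (c - \<xi>)\<^sup>2 = c powr (m - 1) * (c * (c - \<xi>)\<^sup>2)"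
      using assms by (simp add: powr_diff)
    also have "\<dots> \<le> c powr (m - 1) * ((c + 2 * \<xi>) * (c - \<xi>)\<^sup>2)"
      using assms by (intro mult_left_mono mult_right_mono) auto
    also have "\<dots> = G c - G \<xi>"
      by (simp add: G_def right_diff_distrib[symmetric]) (simp add: algebra_simps power2_eq_square power3_eq_cube)
    also have "\<dots> \<le> integral {\<xi>..c} (\<lambda>s. 6 * max 0 (c - s) * s powr m)"
    proof (rule has_integral_le)
      show "((\<lambda>s. c powr (m - 1) * (6 * (c - s) * s)) has_integral G c - G \<xi>) {\<xi>..c}"
      proof (rule fundamental_theorem_of_calculus[OF that])
        fix x
        have "(G has_real_derivative c powr (m - 1) * (6 * (c - x) * x)) (at x)"
          unfolding G_def
          by (auto intro!: derivative_eq_intros simp: algebra_simps power2_eq_square)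
        thus "(G has_vector_derivative c powr (m - 1) * (6 * (c - x) * x)) (at x within {\<xi>..c})"
          by (simp add: has_real_derivative_iff_has_vector_derivative[symmetric] has_field_derivative_at_within)
      qed
      show "((\<lambda>s. 6 * max 0 (c - s) * s powr m) has_integral integral {\<xi>..c} (\<lambda>s. 6 * max 0 (c - s) * s powr m)) {\<xi>..c}"
        by (intro integrable_integral int assms)
      fix s assume s: "s \<in> {\<xi>..c}"
      have "c powr (m - 1) * s \<le> s powr m"
      proof (cases "s = 0")
        case False
        hence s0: "s > 0" using s assms by auto
        have "c powr (m - 1) * s \<le> s powr (m - 1) * s"
          using s s0 assms by (intro mult_right_mono powr_mono2') auto
        also have "\<dots> = s powr m" using s0 by (simp add: powr_diff)
        finally show ?thesis .
      qed simp
      hence "(6 * (c - s)) * (c powr (m - 1) * s) \<le> (6 * (c - s)) * s powr m"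
        using s by (intro mult_left_mono) auto
      thus "c powr (m - 1) * (6 * (c - s) * s) \<le> 6 * max 0 (c - s) * s powr m"
        using s by (simp add: max_def mult_ac)
    qed
    finally show ?thesis using dissip_diff[OF assms(1) cont assms(4) that] by simp
  qed
  show "dissip m (\<lambda>\<xi>. 6 * max 0 (c - \<xi>)) \<xi> = dissip m (\<lambda>\<xi>. 6 * max 0 (c - \<xi>)) c" if "c \<le> \<xi>"
  proof -
    have "integral {c..\<xi>} (\<lambda>s. 6 * max 0 (c - s) * s powr m) = 0"
      by (rule integral_unique, rule has_integral_is_0) auto
    thus ?thesis using dissip_diff[OF assms(1) cont less_imp_le[OF assms(3)] that] by simp
  qed
qed

text \<open>
  For exponents below 2 the power $|\xi|^p$ is not twice differentiable at 0; adding \<open>\<epsilon>\<close> to the square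
  repairs this while keeping the function convex.
\<close>

lemma C2_convex_smoothed_power:
  assumes "p \<ge> 1" "\<epsilon> > 0"
  shows "C2_convex (\<lambda>\<xi>. (\<xi>\<^sup>2 + \<epsilon>) powr (p / 2)) (\<lambda>\<xi>. p * \<xi> * (\<xi>\<^sup>2 + \<epsilon>) powr (p / 2 - 1))
     (\<lambda>\<xi>. p * (\<xi>\<^sup>2 + \<epsilon>) powr (p / 2 - 2) * ((p - 1) * \<xi>\<^sup>2 + \<epsilon>))"
proof -
  have pos: "\<xi>\<^sup>2 + \<epsilon> > 0" for \<xi> :: real using assms by (simp add: add_nonneg_pos)
  have sq: "((\<lambda>\<xi>. \<xi>\<^sup>2 + \<epsilon>) has_real_derivative 2 * \<xi>) (at \<xi>)" for \<xi>
    by (auto intro!: derivative_eq_intros)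
  have pw: "((\<lambda>\<xi>. (\<xi>\<^sup>2 + \<epsilon>) powr a) has_real_derivative a * (\<xi>\<^sup>2 + \<epsilon>) powr (a - 1) * (2 * \<xi>)) (at \<xi>)" for a \<xi>
    by (rule DERIV_chain2[OF has_real_derivative_powr[OF pos] sq])
  have "((\<lambda>\<xi>. (\<xi>\<^sup>2 + \<epsilon>) powr (p / 2)) has_real_derivative p * \<xi> * (\<xi>\<^sup>2 + \<epsilon>) powr (p / 2 - 1)) (at \<xi>)" for \<xi>
    using pw[of "p / 2" \<xi>] by (simp add: mult_ac)
  moreover have "((\<lambda>\<xi>. p * \<xi> * (\<xi>\<^sup>2 + \<epsilon>) powr (p / 2 - 1)) has_real_derivative
      p * (\<xi>\<^sup>2 + \<epsilon>) powr (p / 2 - 2) * ((p - 1) * \<xi>\<^sup>2 + \<epsilon>)) (at \<xi>)" for \<xi>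
  proof -
    have "(\<xi>\<^sup>2 + \<epsilon>) powr (p / 2 - 1) = (\<xi>\<^sup>2 + \<epsilon>) powr (p / 2 - 2) * (\<xi>\<^sup>2 + \<epsilon>)"
      using powr_add[of "\<xi>\<^sup>2 + \<epsilon>" "p / 2 - 2" 1] pos[of \<xi>] by simp
    moreover have "((\<lambda>\<xi>. p * \<xi> * (\<xi>\<^sup>2 + \<epsilon>) powr (p / 2 - 1)) has_real_derivative
       p * (\<xi>\<^sup>2 + \<epsilon>) powr (p / 2 - 1) + (p / 2 - 1) * (\<xi>\<^sup>2 + \<epsilon>) powr (p / 2 - 2) * (2 * \<xi>) * (p * \<xi>)) (at \<xi>)"
      using DERIV_mult[OF DERIV_cmult_Id[of p \<xi>] pw[of "p / 2 - 1" \<xi>]] by simp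
    ultimately show ?thesis by (simp add: algebra_simps power2_eq_square)
  qed
  moreover have "continuous_on UNIV (\<lambda>\<xi>. p * (\<xi>\<^sup>2 + \<epsilon>) powr (p / 2 - 2) * ((p - 1) * \<xi>\<^sup>2 + \<epsilon>))"
    using pos by (intro continuous_intros) (metis less_irrefl)
  moreover have "0 \<le> p * (\<xi>\<^sup>2 + \<epsilon>) powr (p / 2 - 2) * ((p - 1) * \<xi>\<^sup>2 + \<epsilon>)" for \<xi>
    using assms by (intro mult_nonneg_nonneg add_nonneg_nonneg) auto
  ultimately show ?thesis unfolding C2_convex_def by blast
qed

section \<open>Conservation of the spatial mean\<close>

text \<open>
  The weak formulation tested with $(S - t)_+^2$, which is of class $C^1$ and vanishes from time \<open>S\<close> on.
\<close>

lemma weak_formulation_mean: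
  fixes v :: "real \<times> point \<Rightarrow> real"
  assumes weak: "weak_formulation d m K u0 u"
    and u: "(\<lambda>(t, x). u t x) \<in> borel_measurable (spacetime d)"
    and v [measurable]: "v \<in> borel_measurable (spacetime d)"
    and M: "\<And>z. 0 \<le> v z \<and> v z \<le> M"
    and eq: "AE z in spacetime d. u (fst z) (snd z) = v z"
    and S: "S > 0"
  shows "(\<integral>z. 2 * max 0 (S - fst z) * v z \<partial>spacetime d) = torus_mean d u0 * S\<^sup>2"
proof -
  define \<phi> :: "real \<Rightarrow> point \<Rightarrow> real" where "\<phi> = (\<lambda>t x. (max 0 (S - t))\<^sup>2)"
  have der: "((\<lambda>t. (max 0 (S - t))\<^sup>2) has_real_derivative (- 2 * max 0 (S - t))) (at t)" for t
  proof -
    have "((\<lambda>x::real. (max 0 x)\<^sup>2) has_real_derivative 2 * max 0 (S - t)) (at (S - t))"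
      using pos_part_power_has_derivative[of 0 "S - t"] by (simp add: numeral_2_eq_2)
    moreover have "((\<lambda>t. S - t) has_real_derivative - 1) (at t)"
      by (auto intro!: derivative_eq_intros)
    ultimately have "((\<lambda>t. (max 0 (S - t))\<^sup>2) has_real_derivative 2 * max 0 (S - t) * - 1) (at t)"
      by (rule DERIV_chain2)
    thus ?thesis by simp
  qed
  have pt: "partial_t \<phi> t x = - 2 * max 0 (S - t)" if "t \<ge> 0" for t x
    by (rule partial_t_eq(2)[OF _ der that]) (simp add: \<phi>_def)
  have "smooth_upto 0 (\<lambda>t. - 2 * max 0 (S - t))"
    by (auto intro!: continuous_intros)
  from smooth_upto_SucI[OF der this] have "smooth_upto 1 (\<lambda>t. (max 0 (S - t))\<^sup>2)"
    by (simp only: One_nat_def)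
  hence "Ck d 1 \<phi>" by (rule Ck_time) (simp add: \<phi>_def)
  hence "test_C1 d (S + 1) \<phi>"
    unfolding test_C1_def by (auto intro!: exI[of _ S] simp: \<phi>_def)
  hence "(LINT t:{0<..<S+1}|lborel. LINT x|torus d.
           - u t x * partial_t \<phi> t x
           + u t x powr m * (\<Sum>i<d. torus_conv d (K i) (u t) x * partial_x i (\<phi> t) x))
        = (LINT x|torus d. u0 x * \<phi> 0 x)"
    using weak S unfolding weak_formulation_def by simp
  also have "(LINT x|torus d. u0 x * \<phi> 0 x) = torus_mean d u0 * S\<^sup>2"
    using S by (simp add: \<phi>_def torus_mean_def)
  finally have "torus_mean d u0 * S\<^sup>2 = (LINT t:{0<..<S+1}|lborel. LINT x|torus d.
           - u t x * partial_t \<phi> t x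
           + u t x powr m * (\<Sum>i<d. torus_conv d (K i) (u t) x * partial_x i (\<phi> t) x))" ..
  also have "\<dots> = (LINT t:{0<..}|lborel. LINT x|torus d. 2 * max 0 (S - t) * u t x)"
    unfolding set_lebesgue_integral_def
  proof (rule Bochner_Integration.integral_cong)
    have px: "partial_x i (\<phi> t) x = 0" for i t x by (simp add: partial_x_def \<phi>_def)
    show "indicator {0<..<S+1} t *\<^sub>R (LINT x|torus d. - u t x * partial_t \<phi> t x
             + u t x powr m * (\<Sum>i<d. torus_conv d (K i) (u t) x * partial_x i (\<phi> t) x))
        = indicator {0<..} t *\<^sub>R (LINT x|torus d. 2 * max 0 (S - t) * u t x)" for t
      by (auto simp: pt px indicator_def mult_ac)
  qed simp
  also have "\<dots> = (\<integral>z. 2 * max 0 (S - fst z) * v z \<partial>spacetime d)"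
  proof (rule iterated_integral_spacetime)
    show "(\<lambda>(t, x). 2 * max 0 (S - t) * u t x) \<in> borel_measurable (spacetime d)"
      using u by (simp add: case_prod_unfold)
    show "integrable (spacetime d) (\<lambda>z. 2 * max 0 (S - fst z) * v z)"
    proof (rule integrable_spacetime[where B = "2 * S * M" and R = S])
      fix z assume "z \<in> space (spacetime d)"
      hence "fst z > 0" by (simp add: space_spacetime)
      thus "\<bar>2 * max 0 (S - fst z) * v z\<bar> \<le> 2 * S * M * indicator {..S} (fst z)"
        using M[of z] by (auto simp: indicator_def max_def abs_mult intro!: mult_mono)
    qed measurable
    show "AE z in spacetime d. 2 * max 0 (S - fst z) * u (fst z) (snd z) = 2 * max 0 (S - fst z) * v z"
      using eq by eventually_elim simp
  qed
  finally show ?thesis ..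
qed

text \<open>
  Differentiate the identity for the weight $2 (S - t)_+$ in \<open>S\<close>. Since \<open>v\<close> is nonnegative, the
  difference quotients to the right and to the left of \<open>S\<close> bound the integral from above and below.
\<close>

lemma integral_until_eq:
  fixes v :: "real \<times> point \<Rightarrow> real"
  assumes v [measurable]: "v \<in> borel_measurable (spacetime d)"
    and M: "\<And>z. 0 \<le> v z \<and> v z \<le> M"
    and weighted: "\<And>S. S > 0 \<Longrightarrow> (\<integral>z. 2 * max 0 (S - fst z) * v z \<partial>spacetime d) = b * S\<^sup>2"
    and S: "S > 0"
  shows "(\<integral>z. indicator {..<S} (fst z) * v z \<partial>spacetime d) = b * S"
proof -
  have M0: "M \<ge> 0" using M by (meson order_trans)
  have int: "integrable (spacetime d) (\<lambda>z. 2 * max 0 (R - fst z) * v z)" for R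
  proof (rule integrable_spacetime[where B = "2 * \<bar>R\<bar> * M" and R = R])
    fix z assume "z \<in> space (spacetime d)"
    hence "fst z > 0" by (simp add: space_spacetime)
    thus "\<bar>2 * max 0 (R - fst z) * v z\<bar> \<le> 2 * \<bar>R\<bar> * M * indicator {..R} (fst z)"
      using M[of z] by (auto simp: indicator_def max_def abs_mult intro!: mult_mono)
  qed measurable
  have int': "integrable (spacetime d) (\<lambda>z. indicator {..<S} (fst z) * v z)"
    by (rule integrable_spacetime[where B = M and R = S])
       (use M M0 in \<open>auto simp: indicator_def\<close>)
  let ?I = "\<integral>z. indicator {..<S} (fst z) * v z \<partial>spacetime d"
  have bnd: "?I \<le> b * S + b / 2 * h" "b * S - b / 2 * h \<le> ?I" if h: "0 < h" "h < S" for h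
  proof -
    have "2 * h * ?I = (\<integral>z. 2 * h * (indicator {..<S} (fst z) * v z) \<partial>spacetime d)" by simp
    also have "\<dots> \<le> (\<integral>z. 2 * max 0 (S + h - fst z) * v z - 2 * max 0 (S - fst z) * v z \<partial>spacetime d)"
    proof (rule integral_mono)
      fix z :: "real \<times> point"
      have "2 * h * indicator {..<S} (fst z) \<le> 2 * max 0 (S + h - fst z) - 2 * max 0 (S - fst z)"
        using h by (auto simp: indicator_def max_def)
      from mult_right_mono[OF this, of "v z"] M[of z]
      show "2 * h * (indicator {..<S} (fst z) * v z) \<le> 2 * max 0 (S + h - fst z) * v z - 2 * max 0 (S - fst z) * v z"
        by (simp add: left_diff_distrib mult.assoc)
    qed (use int' in \<open>simp_all add: Bochner_Integration.integrable_diff[OF int int]\<close>)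
    also have "\<dots> = b * (S + h)\<^sup>2 - b * S\<^sup>2"
      using int weighted[of S] weighted[of "S + h"] S h by simp
    finally have "h * ?I \<le> h * (b * S + b / 2 * h)"
      by (simp add: power2_eq_square algebra_simps)
    thus "?I \<le> b * S + b / 2 * h" using h by simp
    have "b * S\<^sup>2 - b * (S - h)\<^sup>2
        = (\<integral>z. 2 * max 0 (S - fst z) * v z - 2 * max 0 (S - h - fst z) * v z \<partial>spacetime d)"
      using int weighted[of S] weighted[of "S - h"] S h by simp
    also have "\<dots> \<le> (\<integral>z. 2 * h * (indicator {..<S} (fst z) * v z) \<partial>spacetime d)"
    proof (rule integral_mono)
      fix z :: "real \<times> point"
      have "2 * max 0 (S - fst z) - 2 * max 0 (S - h - fst z) \<le> 2 * h * indicator {..<S} (fst z)"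
        using h by (auto simp: indicator_def max_def)
      from mult_right_mono[OF this, of "v z"] M[of z]
      show "2 * max 0 (S - fst z) * v z - 2 * max 0 (S - h - fst z) * v z \<le> 2 * h * (indicator {..<S} (fst z) * v z)"
        by (simp add: left_diff_distrib mult.assoc)
    qed (use int' in \<open>simp_all add: Bochner_Integration.integrable_diff[OF int int]\<close>)
    also have "\<dots> = 2 * h * ?I" by simp
    finally have "h * (b * S - b / 2 * h) \<le> h * ?I"
      by (simp add: power2_eq_square algebra_simps)
    thus "b * S - b / 2 * h \<le> ?I" using h by simp
  qed
  \<comment> \<open>Both bounds differ from the claim by a multiple of the step \<open>h\<close>.\<close>
  have ev: "\<forall>\<^sub>F h in at_right 0. 0 < h \<and> h < S"
    using S eventually_at_right_field by blast
  have "((\<lambda>h. b * S + b / 2 * h) \<longlongrightarrow> b * S + b / 2 * 0) (at_right 0)"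
    by (intro tendsto_intros)
  hence "?I \<le> b * S + b / 2 * 0"
    by (rule tendsto_lowerbound) (use ev bnd in \<open>auto elim!: eventually_mono\<close>)
  moreover have "((\<lambda>h. b * S - b / 2 * h) \<longlongrightarrow> b * S - b / 2 * 0) (at_right 0)"
    by (intro tendsto_intros)
  hence "b * S - b / 2 * 0 \<le> ?I"
    by (rule tendsto_upperbound) (use ev bnd in \<open>auto elim!: eventually_mono\<close>)
  ultimately show ?thesis by simp
qed

text \<open>
  The integrals up to any two times determine the averages over all windows, and these converge almost
  everywhere to the spatial mean.
\<close>

lemma mean_constant:
  fixes v :: "real \<times> point \<Rightarrow> real"
  assumes v [measurable]: "v \<in> borel_measurable (spacetime d)"
    and M: "\<And>z. 0 \<le> v z \<and> v z \<le> M"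
    and weighted: "\<And>S. S > 0 \<Longrightarrow> (\<integral>z. 2 * max 0 (S - fst z) * v z \<partial>spacetime d) = b * S\<^sup>2"
  shows "AE t in lborel. t > 0 \<longrightarrow> (LINT x|torus d. v (t, x)) = b"
proof -
  have M0: "M \<ge> 0" using M by (meson order_trans)
  have vb: "\<bar>v z\<bar> \<le> M" for z using M[of z] by simp
  have int: "integrable (spacetime d) (\<lambda>z. indicator {..<S} (fst z) * v z)" for S
    by (rule integrable_spacetime[where B = M and R = S])
       (use M M0 in \<open>auto simp: indicator_def\<close>)
  have avg: "(LINT r:{t<..<t+h}|lborel. slice d v r) = b * h" if "t > 0" "h > 0" for t h
  proof -
    have "(LINT r:{t<..<t+h}|lborel. slice d v r) = (\<integral>z. indicator {t<..<t+h} (fst z) * v z \<partial>spacetime d)"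
      by (rule integral_window(2)[OF v vb])
    also have "\<dots> = (\<integral>z. indicator {..<t+h} (fst z) * v z - indicator {..<t} (fst z) * v z \<partial>spacetime d)"
    proof (rule integral_cong_AE)
      show "AE z in spacetime d. indicator {t<..<t+h} (fst z) * v z
          = indicator {..<t+h} (fst z) * v z - indicator {..<t} (fst z) * v z"
        using AE_time_neq[where d = d and c = t] by eventually_elim (use that in \<open>auto simp: indicator_def\<close>)
    qed measurable
    also have "\<dots> = b * (t + h) - b * t"
      using int integral_until_eq[OF v M weighted, of t] integral_until_eq[OF v M weighted, of "t + h"] that
      by simp
    finally show ?thesis by (simp add: algebra_simps)
  qed
  have "AE t in lborel. ((\<lambda>h. (LINT r:{t<..<t+h}|lborel. slice d v r) / h) \<longlongrightarrow> slice d v t) (at_right 0)"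
    by (rule lebesgue_right_average[OF measurable_slice[OF v] slice_bound[OF v vb M0]])
  thus ?thesis
  proof eventually_elim
    case (elim t)
    show ?case
    proof
      assume t: "t > 0"
      have "((\<lambda>h. (LINT r:{t<..<t+h}|lborel. slice d v r) / h) \<longlongrightarrow> b) (at_right 0)"
        by (rule tendsto_eventually) (auto simp: eventually_at_filter avg t)
      hence "slice d v t = b" using elim tendsto_unique trivial_limit_at_right_real by blast
      thus "(LINT x|torus d. v (t, x)) = b" using t by (simp add: slice_def)
    qed
  qed
qed

section \<open>Entropies tested with functions of time\<close>

text \<open>
  For a test function of time alone the divergence term drops out. What remains of the source term is
  \<open>- H (u - b)\<close>, because the spatial mean is \<open>b\<close> for almost every time. The statement is about a bounded
  representative \<open>v\<close> of the solution, so that all integrals are integrals of bounded functions.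
\<close>

lemma entropy_inequality_time:
  fixes v :: "real \<times> point \<Rightarrow> real"
  assumes ent: "entropy_inequality d m K u"
    and u: "(\<lambda>(t, x). u t x) \<in> borel_measurable (spacetime d)"
    and v [measurable]: "v \<in> borel_measurable (spacetime d)"
    and M: "\<And>z. 0 \<le> v z \<and> v z \<le> M"
    and eq: "AE z in spacetime d. u (fst z) (snd z) = v z"
    and mean: "AE t in lborel. t > 0 \<longrightarrow> (LINT x|torus d. v (t, x)) = b"
    and m: "m > 0" and \<eta>: "C2_convex \<eta> \<eta>' \<eta>''"
    and \<theta>: "\<And>k. smooth_upto k \<theta>" "\<And>t. 0 \<le> \<theta> t" "0 < a" "\<And>t. t \<notin> {a..R} \<Longrightarrow> \<theta> t = 0"
  shows "- (\<integral>z. \<eta> (v z) * deriv \<theta> (fst z) \<partial>spacetime d)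
     \<le> - (\<integral>z. \<theta> (fst z) * (dissip m \<eta>'' (v z) * (v z - b)) \<partial>spacetime d)"
proof -
  note \<eta>D = \<eta>[unfolded C2_convex_def]
  define H where "H = dissip m \<eta>''"
  have contH: "continuous_on UNIV H" unfolding H_def using \<eta>D m by (intro continuous_on_dissip) auto
  have cont\<eta>: "continuous_on UNIV \<eta>" by (rule C2_convex_continuous(1)[OF \<eta>])
  have cont\<theta>: "continuous_on UNIV \<theta>" "continuous_on UNIV (deriv \<theta>)"
    using \<theta>(1)[of 0] \<theta>(1)[of 1] by auto
  note [measurable] = borel_measurable_continuous_onI[OF contH] borel_measurable_continuous_onI[OF cont\<eta>]
    borel_measurable_continuous_onI[OF cont\<theta>(1)] borel_measurable_continuous_onI[OF cont\<theta>(2)]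
  have M0: "M \<ge> 0" using M by (meson order_trans)
  obtain B1 where B1: "B1 \<ge> 0" "\<And>x. x \<in> {0..M} \<Longrightarrow> \<bar>\<eta> x\<bar> \<le> B1"
    using continuous_on_compact_bound[OF cont\<eta>, of "{0..M}"] by auto
  obtain B2 where B2: "B2 \<ge> 0" "\<And>x. x \<in> {0..M} \<Longrightarrow> \<bar>H x\<bar> \<le> B2"
    using continuous_on_compact_bound[OF contH, of "{0..M}"] by auto
  obtain B3 where B3: "B3 \<ge> 0" "\<And>x. x \<in> {0..R} \<Longrightarrow> \<bar>\<theta> x\<bar> \<le> B3"
    using continuous_on_compact_bound[OF cont\<theta>(1), of "{0..R}"] by auto
  obtain B4 where B4: "B4 \<ge> 0" "\<And>x. x \<in> {0..R} \<Longrightarrow> \<bar>deriv \<theta> x\<bar> \<le> B4"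
    using continuous_on_compact_bound[OF cont\<theta>(2), of "{0..R}"] by auto
  have d\<theta>: "(\<theta> has_real_derivative deriv \<theta> t) (at t)" for t
    using \<theta>(1)[of 1] smooth_upto_SucE(1)[of 0 \<theta>] by simp
  have zero: "\<theta> t = 0" "deriv \<theta> t = 0" if "t > R" for t
  proof -
    show "\<theta> t = 0" using that by (intro \<theta>(4)) auto
    have "((\<lambda>_. 0) has_real_derivative 0) (at t)" by simp
    hence "(\<theta> has_real_derivative 0) (at t)"
      by (rule DERIV_cong_ev[THEN iffD1, rotated -1])
         (use that in \<open>auto simp: eventually_nhds intro!: exI[of _ "{R<..}"] \<theta>(4)\<close>)
    thus "deriv \<theta> t = 0" by (rule DERIV_imp_deriv)
  qed
  define \<phi> :: "real \<Rightarrow> point \<Rightarrow> real" where "\<phi> = (\<lambda>t x. \<theta> t)"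
  have "Ck d k \<phi>" for k by (rule Ck_time[OF \<theta>(1)]) (simp add: \<phi>_def)
  moreover have "\<exists>a>0. \<exists>b. \<forall>t\<ge>0. t \<notin> {a..b} \<longrightarrow> (\<forall>x\<in>euclid d. \<phi> t x = 0)"
    using \<theta>(3,4) unfolding \<phi>_def by blast
  ultimately have "test_nonneg d \<phi>"
    unfolding test_nonneg_def using \<theta>(2) by (auto simp: \<phi>_def)
  with ent entropy_pair_dissip(1)[OF m \<eta>] have
    "- (LINT t:{0<..}|lborel. LINT x|torus d. \<eta> (u t x) * partial_t \<phi> t x)
        \<le> - (LINT t:{0<..}|lborel. LINT x|torus d.
               (\<eta>' (u t x) * u t x powr m - dissip m \<eta>'' (u t x))
               * (\<Sum>i<d. torus_conv d (K i) (u t) x * partial_x i (\<phi> t) x))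
          + (LINT t:{0<..}|lborel. LINT x|torus d.
               ((\<eta>' (u t x) * u t x powr m - dissip m \<eta>'' (u t x)) - deriv \<eta> (u t x) * u t x powr m)
               * (u t x - torus_mean d (u t)) * \<phi> t x)"
    unfolding entropy_inequality_def by blast
  also have "(LINT t:{0<..}|lborel. LINT x|torus d. \<eta> (u t x) * partial_t \<phi> t x)
      = (LINT t:{0<..}|lborel. LINT x|torus d. \<eta> (u t x) * deriv \<theta> t)"
    unfolding set_lebesgue_integral_def
    by (intro Bochner_Integration.integral_cong)
       (auto simp: indicator_def \<phi>_def partial_t_eq(2)[OF _ d\<theta>])
  also have "\<dots> = (\<integral>z. \<eta> (v z) * deriv \<theta> (fst z) \<partial>spacetime d)"
  proof (rule iterated_integral_spacetime)
    show "(\<lambda>(t, x). \<eta> (u t x) * deriv \<theta> t) \<in> borel_measurable (spacetime d)"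
      using u unfolding case_prod_unfold by measurable
    show "integrable (spacetime d) (\<lambda>z. \<eta> (v z) * deriv \<theta> (fst z))"
    proof (rule integrable_spacetime[where B = "B1 * B4" and R = R])
      fix z assume "z \<in> space (spacetime d)"
      hence "fst z > 0" by (simp add: space_spacetime)
      thus "\<bar>\<eta> (v z) * deriv \<theta> (fst z)\<bar> \<le> B1 * B4 * indicator {..R} (fst z)"
        using M[of z] B1 B4 zero(2)[of "fst z"]
        by (cases "fst z \<le> R") (auto simp: indicator_def abs_mult intro!: mult_mono)
    qed measurable
    show "AE z in spacetime d. \<eta> (u (fst z) (snd z)) * deriv \<theta> (fst z) = \<eta> (v z) * deriv \<theta> (fst z)"
      using eq by eventually_elim simp
  qed
  also have "(LINT t:{0<..}|lborel. LINT x|torus d.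
               (\<eta>' (u t x) * u t x powr m - dissip m \<eta>'' (u t x))
               * (\<Sum>i<d. torus_conv d (K i) (u t) x * partial_x i (\<phi> t) x)) = 0"
    by (simp add: \<phi>_def partial_x_def)
  also have "(LINT t:{0<..}|lborel. LINT x|torus d.
               ((\<eta>' (u t x) * u t x powr m - dissip m \<eta>'' (u t x)) - deriv \<eta> (u t x) * u t x powr m)
               * (u t x - torus_mean d (u t)) * \<phi> t x)
     = (\<integral>z. - (\<theta> (fst z) * (H (v z) * (v z - b))) \<partial>spacetime d)"
  proof (rule iterated_integral_spacetime)
    have *: "((\<eta>' (u t x) * u t x powr m - dissip m \<eta>'' (u t x)) - deriv \<eta> (u t x) * u t x powr m)
               * (u t x - torus_mean d (u t)) * \<phi> t x = - H (u t x) * (u t x - torus_mean d (u t)) * \<theta> t" for t x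
      by (simp add: entropy_pair_dissip(2)[OF m \<eta>] \<phi>_def H_def)
    interpret P: pair_sigma_finite "restrict_space (lborel :: real measure) {0<..}" "torus d"
      by (rule pair_sigma_finite_spacetime)
    have "(\<lambda>t. LINT x|torus d. u t x) \<in> borel_measurable (restrict_space lborel {0<..})"
      using u by (intro P.M2.borel_measurable_lebesgue_integral) (simp add: spacetime_def)
    hence mm: "(\<lambda>z. torus_mean d (u (fst z))) \<in> borel_measurable (spacetime d)"
      unfolding torus_mean_def spacetime_def by (rule measurable_compose[OF measurable_fst])
    show "(\<lambda>(t, x). ((\<eta>' (u t x) * u t x powr m - dissip m \<eta>'' (u t x)) - deriv \<eta> (u t x) * u t x powr m)
               * (u t x - torus_mean d (u t)) * \<phi> t x) \<in> borel_measurable (spacetime d)"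
      using u mm unfolding * case_prod_unfold by measurable
    show "integrable (spacetime d) (\<lambda>z. - (\<theta> (fst z) * (H (v z) * (v z - b))))"
    proof (rule integrable_spacetime[where B = "B3 * (B2 * (M + \<bar>b\<bar>))" and R = R])
      fix z assume "z \<in> space (spacetime d)"
      hence z: "fst z > 0" by (simp add: space_spacetime)
      have "\<bar>v z - b\<bar> \<le> M + \<bar>b\<bar>" using M[of z] by auto
      thus "\<bar>- (\<theta> (fst z) * (H (v z) * (v z - b)))\<bar> \<le> B3 * (B2 * (M + \<bar>b\<bar>)) * indicator {..R} (fst z)"
        using M[of z] B2 B3 zero(1)[of "fst z"] z M0
        by (cases "fst z \<le> R") (auto simp: indicator_def abs_mult intro!: mult_mono)
    qed measurable
    have "AE t in lborel. t > 0 \<longrightarrow> torus_mean d (u t) = b"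
      using AE_spacetime_D[OF eq] mean
    proof eventually_elim
      case (elim t)
      show ?case
      proof
        assume t: "t > 0"
        have "torus_mean d (u t) = (LINT x|torus d. v (t, x))"
          unfolding torus_mean_def
          using elim(1) t measurable_section[OF u t] measurable_section[OF v t]
          by (intro integral_cong_AE) auto
        thus "torus_mean d (u t) = b" using elim(2) t by simp
      qed
    qed
    hence "AE z in spacetime d. torus_mean d (u (fst z)) = b"
      using mm by (intro AE_spacetime_I) (auto elim!: eventually_mono)
    with eq show "AE z in spacetime d. ((\<eta>' (u (fst z) (snd z)) * u (fst z) (snd z) powr m - dissip m \<eta>'' (u (fst z) (snd z)))
             - deriv \<eta> (u (fst z) (snd z)) * u (fst z) (snd z) powr m)
               * (u (fst z) (snd z) - torus_mean d (u (fst z))) * \<phi> (fst z) (snd z)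
          = - (\<theta> (fst z) * (H (v z) * (v z - b)))"
      unfolding * by eventually_elim simp
  qed
  finally show ?thesis by (simp add: H_def)
qed

section \<open>Monotonicity of averages over time windows\<close>

text \<open>
  All that the estimates use of an entropy solution: a representative with values in \<open>[0, M]\<close>, the
  conserved mean, and the entropy inequality integrated over the torus.
\<close>

locale averaged_solution =
  fixes d :: nat and m b M :: real and v :: "real \<times> point \<Rightarrow> real"
  assumes m_pos: "m > 0" and b_nonneg: "0 \<le> b"
    and v_measurable [measurable]: "v \<in> borel_measurable (spacetime d)"
    and v_bounds: "0 \<le> v z" "v z \<le> M"
    and v_mean: "AE t in lborel. t > 0 \<longrightarrow> (LINT x|torus d. v (t, x)) = b"
    and v_entropy: "C2_convex \<eta> \<eta>' \<eta>'' \<Longrightarrow> (\<And>k. smooth_upto k \<theta>) \<Longrightarrow> (\<And>t. 0 \<le> \<theta> t) \<Longrightarrow>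
      0 < a \<Longrightarrow> (\<And>t. t \<notin> {a..R} \<Longrightarrow> \<theta> t = 0) \<Longrightarrow>
      - (\<integral>z. \<eta> (v z) * deriv \<theta> (fst z) \<partial>spacetime d)
        \<le> - (\<integral>z. \<theta> (fst z) * (dissip m \<eta>'' (v z) * (v z - b)) \<partial>spacetime d)"
begin

lemma integrable_profile:
  fixes f \<theta> :: "real \<Rightarrow> real"
  assumes f: "continuous_on UNIV f"
    and [measurable]: "\<theta> \<in> borel_measurable borel"
    and \<theta>: "\<And>t. \<bar>\<theta> t\<bar> \<le> B * indicator {..R} t"
  shows "integrable (spacetime d) (\<lambda>z. \<theta> (fst z) * f (v z))"
proof -
  note [measurable] = borel_measurable_continuous_onI[OF f]
  obtain C where C: "C \<ge> 0" "\<And>x. x \<in> {0..M} \<Longrightarrow> \<bar>f x\<bar> \<le> C"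
    using continuous_on_compact_bound[OF f, of "{0..M}"] by auto
  show ?thesis
  proof (rule integrable_spacetime[where B = "B * C" and R = R])
    fix z :: "real \<times> point"
    have "\<bar>\<theta> (fst z) * f (v z)\<bar> \<le> (B * indicator {..R} (fst z)) * C"
      unfolding abs_mult using \<theta>[of "fst z"] C(2)[of "v z"] v_bounds[of z]
      by (intro mult_mono) (auto intro: order_trans[OF abs_ge_zero])
    thus "\<bar>\<theta> (fst z) * f (v z)\<bar> \<le> B * C * indicator {..R} (fst z)" by (simp add: mult_ac)
  qed measurable
qed

text \<open>
  This is why a function of time may be subtracted from the dissipation without changing its integral
  against \<open>v - b\<close>.
\<close>

lemma integral_fluctuation:
  assumes [measurable]: "\<theta> \<in> borel_measurable borel"
    and \<theta>: "\<And>t. \<bar>\<theta> t\<bar> \<le> B * indicator {..R} t"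
  shows "(\<integral>z. \<theta> (fst z) * (v z - b) \<partial>spacetime d) = 0"
proof -
  interpret Q: prob_space "torus d" by (rule prob_space_torus)
  have int: "integrable (spacetime d) (\<lambda>z. \<theta> (fst z) * (v z - b))"
    by (rule integrable_profile[OF _ _ \<theta>]) (auto intro!: continuous_intros)
  have "(LINT t:{0<..}|lborel. LINT x|torus d. \<theta> t * (v (t, x) - b)) = (\<integral>z. \<theta> (fst z) * (v z - b) \<partial>spacetime d)"
    by (rule iterated_integral_spacetime[OF _ int]) (simp_all add: case_prod_unfold)
  hence "(\<integral>z. \<theta> (fst z) * (v z - b) \<partial>spacetime d)
      = (\<integral>t. slice d (\<lambda>z. \<theta> (fst z) * (v z - b)) t \<partial>lborel)"
    by (simp add: slice_def set_lebesgue_integral_def)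
  also have "\<dots> = (\<integral>t. 0 \<partial>(lborel :: real measure))"
  proof (rule integral_cong_AE)
    show "slice d (\<lambda>z. \<theta> (fst z) * (v z - b)) \<in> borel_measurable lborel"
      by (simp add: measurable_slice)
    show "AE t in lborel. slice d (\<lambda>z. \<theta> (fst z) * (v z - b)) t = 0"
      using v_mean
    proof eventually_elim
      case (elim t)
      have "(LINT x|torus d. \<theta> t * (v (t, x) - b)) = 0" if t: "t > 0"
      proof -
        have "integrable (torus d) (\<lambda>x. v (t, x))"
          by (rule Q.integrable_const_bound[of _ M])
             (use v_bounds measurable_section[OF v_measurable t] in auto)
        thus ?thesis using elim t by (simp add: Q.prob_space)
      qed
      thus ?case by (auto simp: slice_def indicator_def)
    qed
  qed simp
  finally show ?thesis by simp
qed

text \<open>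
  Differentiate the right-hand side in \<open>s\<close>. The derivative falls on \<open>\<Psi>\<close>, giving \<open>\<Psi>t\<close>, and on the translated
  bump, giving minus its time derivative. For the latter the entropy inequality at the frozen entropy \<open>\<Psi> s\<close> applies,
  with the bump as test function; so the chain rule in time is never applied to \<open>v\<close> itself.
\<close>

lemma smoothed_window_antimono:
  fixes \<Psi> \<Psi>t \<Psi>x \<Psi>xx :: "real \<Rightarrow> real \<Rightarrow> real"
  assumes convex: "\<And>t. 0 < t \<Longrightarrow> t < T \<Longrightarrow> C2_convex (\<Psi> t) (\<Psi>x t) (\<Psi>xx t)"
    and der: "\<And>t \<xi>. 0 < t \<Longrightarrow> t < T \<Longrightarrow> ((\<lambda>s. \<Psi> s \<xi>) has_real_derivative \<Psi>t t \<xi>) (at t)"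
    and cont: "continuous_on ({0<..<T} \<times> UNIV) (\<lambda>(t, \<xi>). \<Psi> t \<xi>)"
    and cont_t: "continuous_on ({0<..<T} \<times> UNIV) (\<lambda>(t, \<xi>). \<Psi>t t \<xi>)"
    and ineq: "\<And>t \<xi>. 0 < t \<Longrightarrow> t < T \<Longrightarrow> 0 \<le> \<xi> \<Longrightarrow> \<xi> \<le> M \<Longrightarrow>
        \<Psi>t t \<xi> + (a t - dissip m (\<Psi>xx t) \<xi>) * (\<xi> - b) \<le> 0"
    and st: "0 < s" "s \<le> t" "t < T" and l: "l > 0" and h: "h > 0"
  shows "(\<integral>z. bump l h (fst z - t) * \<Psi> t (v z) \<partial>spacetime d)
      \<le> (\<integral>z. bump l h (fst z - s) * \<Psi> s (v z) \<partial>spacetime d)"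
proof -
  define \<beta> where "\<beta> = bump l h"
  define \<beta>' where "\<beta>' = deriv \<beta>"
  have sm: "smooth_upto k \<beta>" for k
    using smooth_upto_bump[of k l h 0] by (simp add: \<beta>_def)
  have \<beta>_der: "(\<beta> has_real_derivative \<beta>' x) (at x)" for x
    using sm[of 1] smooth_upto_SucE(1)[of 0 \<beta>] by (simp add: \<beta>'_def)
  have cont\<beta>: "continuous_on UNIV \<beta>" "continuous_on UNIV \<beta>'"
    using sm[of 0] sm[of 1] by (auto simp: \<beta>'_def)
  note [measurable] = borel_measurable_continuous_onI[OF cont\<beta>(1)] borel_measurable_continuous_onI[OF cont\<beta>(2)]
  have \<beta>_zero: "\<beta> x = 0" if "x \<notin> {0..h}" for x
    using bump_eq_0[OF l, of x h] that by (auto simp: \<beta>_def)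
  have \<beta>'_zero: "\<beta>' x = 0" if "x \<notin> {0..h}" for x
  proof -
    have "((\<lambda>_. 0) has_real_derivative 0) (at x)" by simp
    hence "(\<beta> has_real_derivative 0) (at x)"
      by (rule DERIV_cong_ev[THEN iffD1, rotated -1])
         (use that \<beta>_zero in \<open>auto simp: eventually_nhds intro!: exI[of _ "- {0..h}"]\<close>)
    thus ?thesis using \<beta>_der DERIV_unique by blast
  qed
  have \<beta>_le: "\<bar>\<beta> x\<bar> \<le> 1" "\<beta> x \<ge> 0" for x using bump_bounds[of l h x] by (auto simp: \<beta>_def)
  obtain D where D: "D \<ge> 0" "\<And>x. x \<in> {0..h} \<Longrightarrow> \<bar>\<beta>' x\<bar> \<le> D"
    using continuous_on_compact_bound[OF cont\<beta>(2), of "{0..h}"] by auto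
  have \<beta>'_le: "\<bar>\<beta>' x\<bar> \<le> D" for x using D \<beta>'_zero[of x] by (cases "x \<in> {0..h}") auto
  have \<Psi>_cont: "continuous_on UNIV (\<Psi> r)" "continuous_on UNIV (\<Psi>t r)" if "0 < r" "r < T" for r
    using continuous_on_section[OF cont, of r] continuous_on_section[OF cont_t, of r] that by auto
  have ind: "\<bar>\<beta> (x - r)\<bar> \<le> 1 * indicator {..q + h} x" "\<bar>\<beta>' (x - r)\<bar> \<le> D * indicator {..q + h} x"
    if "r \<le> q" for x r q
    using \<beta>_le[of "x - r"] \<beta>'_le[of "x - r"] \<beta>_zero[of "x - r"] \<beta>'_zero[of "x - r"] that
    by (auto simp: indicator_def)
  define F where "F = (\<lambda>r z. \<beta> (fst z - r) * \<Psi> r (v z))"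
  define F' where "F' = (\<lambda>r z. - \<beta>' (fst z - r) * \<Psi> r (v z) + \<beta> (fst z - r) * \<Psi>t r (v z))"
  have F_int: "integrable (spacetime d) (F r)" if "0 < r" "r < T" for r
    unfolding F_def by (rule integrable_profile[OF \<Psi>_cont(1)[OF that] _ ind(1)[OF order_refl]]) measurable
  have i1: "integrable (spacetime d) (\<lambda>z. \<beta>' (fst z - r) * \<Psi> r (v z))" if "0 < r" "r < T" for r
    by (rule integrable_profile[OF \<Psi>_cont(1)[OF that] _ ind(2)[OF order_refl]]) measurable
  have i2: "integrable (spacetime d) (\<lambda>z. \<beta> (fst z - r) * \<Psi>t r (v z))" if "0 < r" "r < T" for r
    by (rule integrable_profile[OF \<Psi>_cont(2)[OF that] _ ind(1)[OF order_refl]]) measurable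
  have F_der: "((\<lambda>r. \<integral>z. F r z \<partial>spacetime d) has_real_derivative (\<integral>z. F' r z \<partial>spacetime d)) (at r)"
    if r: "0 < r" "r < T" for r
  proof -
    \<comment> \<open>A compact neighbourhood of \<open>r\<close> inside \<open>(0, T)\<close>, on which \<open>\<Psi>\<close> and \<open>\<Psi>t\<close> are bounded.\<close>
    define p q where "p = r / 2" and "q = (r + T) / 2"
    have pq: "0 < p" "p < r" "r < q" "q < T" using r by (auto simp: p_def q_def field_simps)
    have sub: "{p..q} \<times> {0..M} \<subseteq> {0<..<T} \<times> UNIV" using pq by auto
    obtain B1 where B1: "B1 \<ge> 0" "\<And>x. x \<in> {p..q} \<times> {0..M} \<Longrightarrow> \<bar>(\<lambda>(t, \<xi>). \<Psi> t \<xi>) x\<bar> \<le> B1"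
      by (rule continuous_on_compact_bound[OF cont _ sub]) (auto intro: compact_Times)
    obtain B2 where B2: "B2 \<ge> 0" "\<And>x. x \<in> {p..q} \<times> {0..M} \<Longrightarrow> \<bar>(\<lambda>(t, \<xi>). \<Psi>t t \<xi>) x\<bar> \<le> B2"
      by (rule continuous_on_compact_bound[OF cont_t _ sub]) (auto intro: compact_Times)
    show ?thesis
    proof (rule has_derivative_under_integral[OF pq(2,3)])
      show "integrable (spacetime d) (F s)" if "p < s" "s < q" for s
        using that pq by (intro F_int) auto
      show "F' r \<in> borel_measurable (spacetime d)"
        using i1[OF r] i2[OF r] unfolding F'_def by simp
      show "integrable (spacetime d) (\<lambda>z. (D * B1 + B2) * indicator {..q + h} (fst z))"
        by (rule integrable_spacetime_indicator)
    next
      fix s and z :: "real \<times> point" assume s: "p < s" "s < q"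
      have "((\<lambda>r. \<beta> (fst z - r)) has_real_derivative \<beta>' (fst z - s) * - 1) (at s)"
        by (rule DERIV_chain2[OF \<beta>_der]) (auto intro!: derivative_eq_intros)
      from DERIV_mult[OF this der[of s "v z"]] s pq
      show "((\<lambda>s. F s z) has_real_derivative F' s z) (at s)"
        by (simp add: F_def F'_def mult_ac add_ac)
      have "\<bar>\<Psi> s (v z)\<bar> \<le> B1" "\<bar>\<Psi>t s (v z)\<bar> \<le> B2"
        using B1(2)[of "(s, v z)"] B2(2)[of "(s, v z)"] s v_bounds[of z] by auto
      hence "\<bar>\<beta>' (fst z - s)\<bar> * \<bar>\<Psi> s (v z)\<bar> + \<bar>\<beta> (fst z - s)\<bar> * \<bar>\<Psi>t s (v z)\<bar>
         \<le> (D * indicator {..q + h} (fst z)) * B1 + (1 * indicator {..q + h} (fst z)) * B2"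
        using s D(1) by (intro add_mono mult_mono ind) auto
      moreover have "\<bar>F' s z\<bar> \<le> \<bar>\<beta>' (fst z - s)\<bar> * \<bar>\<Psi> s (v z)\<bar> + \<bar>\<beta> (fst z - s)\<bar> * \<bar>\<Psi>t s (v z)\<bar>"
        unfolding F'_def by (rule order_trans[OF abs_triangle_ineq]) (simp add: abs_mult)
      ultimately show "\<bar>F' s z\<bar> \<le> (D * B1 + B2) * indicator {..q + h} (fst z)"
        by (simp add: algebra_simps)
    qed
  qed
  have F'_nonpos: "(\<integral>z. F' r z \<partial>spacetime d) \<le> 0" if r: "0 < r" "r < T" for r
  proof -
    note C2 = convex[OF r]
    have dcont: "continuous_on UNIV (dissip m (\<Psi>xx r))"
      using C2 m_pos by (intro continuous_on_dissip) (auto simp: C2_convex_def)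
    have i3: "integrable (spacetime d) (\<lambda>z. \<beta> (fst z - r) * (dissip m (\<Psi>xx r) (v z) * (v z - b)))"
      by (rule integrable_profile[OF _ _ ind(1)[OF order_refl]])
         (auto intro!: continuous_intros continuous_on_subset[OF dcont])
    have i4: "integrable (spacetime d) (\<lambda>z. \<beta> (fst z - r) * (v z - b))"
      by (rule integrable_profile[OF _ _ ind(1)[OF order_refl]]) (auto intro!: continuous_intros)
    have "((\<lambda>x. \<beta> (x - r)) has_real_derivative \<beta>' (x - r)) (at x)" for x
      using DERIV_shift[of \<beta> "\<beta>' (x - r)" x "- r"] \<beta>_der by simp
    hence dshift: "deriv (\<lambda>x. \<beta> (x - r)) = (\<lambda>x. \<beta>' (x - r))"
      by (intro ext DERIV_imp_deriv)
    have "- (\<integral>z. \<Psi> r (v z) * deriv (\<lambda>x. \<beta> (x - r)) (fst z) \<partial>spacetime d)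
        \<le> - (\<integral>z. \<beta> (fst z - r) * (dissip m (\<Psi>xx r) (v z) * (v z - b)) \<partial>spacetime d)"
      by (rule v_entropy[OF C2, where a = r and R = "r + h"])
         (use \<beta>_le \<beta>_zero r smooth_upto_bump in \<open>auto simp: \<beta>_def\<close>)
    hence 1: "- (\<integral>z. \<beta>' (fst z - r) * \<Psi> r (v z) \<partial>spacetime d)
        \<le> - (\<integral>z. \<beta> (fst z - r) * (dissip m (\<Psi>xx r) (v z) * (v z - b)) \<partial>spacetime d)"
      by (simp add: dshift mult.commute)
    have "(\<integral>z. F' r z \<partial>spacetime d) = - (\<integral>z. \<beta>' (fst z - r) * \<Psi> r (v z) \<partial>spacetime d)
         + (\<integral>z. \<beta> (fst z - r) * \<Psi>t r (v z) \<partial>spacetime d)"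
      using i1[OF r] i2[OF r] by (simp add: F'_def)
    also have "\<dots> \<le> - (\<integral>z. \<beta> (fst z - r) * (dissip m (\<Psi>xx r) (v z) * (v z - b)) \<partial>spacetime d)
         + (\<integral>z. \<beta> (fst z - r) * \<Psi>t r (v z) \<partial>spacetime d)"
      using 1 by simp
    also have "\<dots> = (\<integral>z. \<beta> (fst z - r) * \<Psi>t r (v z)
         - \<beta> (fst z - r) * (dissip m (\<Psi>xx r) (v z) * (v z - b)) \<partial>spacetime d)"
      using i2[OF r] i3 by simp
    also have "\<dots> \<le> (\<integral>z. - a r * (\<beta> (fst z - r) * (v z - b)) \<partial>spacetime d)"
    proof (rule integral_mono)
      fix z :: "real \<times> point"
      have "\<Psi>t r (v z) - dissip m (\<Psi>xx r) (v z) * (v z - b) \<le> - a r * (v z - b)"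
        using ineq[OF r v_bounds[of z]] by (simp add: algebra_simps)
      from mult_left_mono[OF this \<beta>_le(2)[of "fst z - r"]]
      show "\<beta> (fst z - r) * \<Psi>t r (v z) - \<beta> (fst z - r) * (dissip m (\<Psi>xx r) (v z) * (v z - b))
          \<le> - a r * (\<beta> (fst z - r) * (v z - b))"
        by (simp add: algebra_simps)
    qed (use i2[OF r] i3 i4 in auto)
    also have "\<dots> = - a r * (\<integral>z. \<beta> (fst z - r) * (v z - b) \<partial>spacetime d)" by simp
    also have "(\<integral>z. \<beta> (fst z - r) * (v z - b) \<partial>spacetime d) = 0"
      by (rule integral_fluctuation[OF _ ind(1)[OF order_refl]]) measurable
    finally show ?thesis by simp
  qed
  have "(\<integral>z. F t z \<partial>spacetime d) \<le> (\<integral>z. F s z \<partial>spacetime d)"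
  proof (rule DERIV_nonpos_imp_nonincreasing[OF st(2)])
    fix r assume "s \<le> r" "r \<le> t"
    hence r: "0 < r" "r < T" using st by auto
    show "\<exists>y. ((\<lambda>r. \<integral>z. F r z \<partial>spacetime d) has_real_derivative y) (at r) \<and> y \<le> 0"
      by (intro exI conjI) (rule F_der[OF r], rule F'_nonpos[OF r])
  qed
  thus ?thesis by (simp add: F_def \<beta>_def)
qed

text \<open>
  The bumps converge to the indicator of the window.
\<close>

theorem window_antimono:
  fixes \<Psi> \<Psi>t \<Psi>x \<Psi>xx :: "real \<Rightarrow> real \<Rightarrow> real"
  assumes convex: "\<And>t. 0 < t \<Longrightarrow> t < T \<Longrightarrow> C2_convex (\<Psi> t) (\<Psi>x t) (\<Psi>xx t)"
    and der: "\<And>t \<xi>. 0 < t \<Longrightarrow> t < T \<Longrightarrow> ((\<lambda>s. \<Psi> s \<xi>) has_real_derivative \<Psi>t t \<xi>) (at t)"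
    and cont: "continuous_on ({0<..<T} \<times> UNIV) (\<lambda>(t, \<xi>). \<Psi> t \<xi>)"
    and cont_t: "continuous_on ({0<..<T} \<times> UNIV) (\<lambda>(t, \<xi>). \<Psi>t t \<xi>)"
    and ineq: "\<And>t \<xi>. 0 < t \<Longrightarrow> t < T \<Longrightarrow> 0 \<le> \<xi> \<Longrightarrow> \<xi> \<le> M \<Longrightarrow>
        \<Psi>t t \<xi> + (a t - dissip m (\<Psi>xx t) \<xi>) * (\<xi> - b) \<le> 0"
    and st: "0 < s" "s \<le> t" "t < T" and h: "h > 0"
  shows "(\<integral>z. indicator {t<..<t+h} (fst z) * \<Psi> t (v z) \<partial>spacetime d)
      \<le> (\<integral>z. indicator {s<..<s+h} (fst z) * \<Psi> s (v z) \<partial>spacetime d)"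
proof -
  define l where "l = (\<lambda>n. inverse (real (Suc n)))"
  have l0: "filterlim l (at_right 0) sequentially"
    unfolding l_def
    by (rule tendsto_imp_filterlim_at_right[OF LIMSEQ_inverse_real_of_nat]) simp
  have lim: "(\<lambda>n. \<integral>z. bump (l n) h (fst z - r) * \<Psi> r (v z) \<partial>spacetime d)
     \<longlonglongrightarrow> (\<integral>z. indicator {r<..<r+h} (fst z) * \<Psi> r (v z) \<partial>spacetime d)" if r: "0 < r" "r < T" for r
  proof -
    have c: "continuous_on UNIV (\<Psi> r)"
      using continuous_on_section[OF cont, of r] r by simp
    have [measurable]: "bump (l n) h \<in> borel_measurable borel" for n
      using smooth_upto_bump[of 0 "l n" h 0] by (simp add: borel_measurable_continuous_onI)
    note [measurable] = borel_measurable_continuous_onI[OF c]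
    obtain B where B: "B \<ge> 0" "\<And>x. x \<in> {0..M} \<Longrightarrow> \<bar>\<Psi> r x\<bar> \<le> B"
      using continuous_on_compact_bound[OF c, of "{0..M}"] by auto
    show ?thesis
    proof (rule integral_dominated_convergence)
      show "integrable (spacetime d) (\<lambda>z. B * indicator {..r + h} (fst z))"
        by (rule integrable_spacetime_indicator)
      show "AE z in spacetime d. (\<lambda>n. bump (l n) h (fst z - r) * \<Psi> r (v z))
          \<longlonglongrightarrow> indicator {r<..<r+h} (fst z) * \<Psi> r (v z)"
      proof (rule AE_I2)
        fix z :: "real \<times> point"
        have "indicator {0<..<h} (fst z - r) = (indicator {r<..<r+h} (fst z) :: real)"
          by (auto simp: indicator_def)
        thus "(\<lambda>n. bump (l n) h (fst z - r) * \<Psi> r (v z)) \<longlonglongrightarrow> indicator {r<..<r+h} (fst z) * \<Psi> r (v z)"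
          using filterlim_compose[OF bump_tendsto_indicator l0, of h "fst z - r"]
          by (intro tendsto_intros) simp
      qed
      show "AE z in spacetime d. norm (bump (l n) h (fst z - r) * \<Psi> r (v z)) \<le> B * indicator {..r + h} (fst z)" for n
      proof (rule AE_I2)
        fix z :: "real \<times> point"
        have "l n > 0" by (simp add: l_def)
        hence "\<bar>bump (l n) h (fst z - r)\<bar> \<le> indicator {..r + h} (fst z)"
          using bump_bounds[of "l n" h "fst z - r"] bump_eq_0[of "l n" "fst z - r" h]
          by (auto simp: indicator_def)
        hence "\<bar>bump (l n) h (fst z - r)\<bar> * \<bar>\<Psi> r (v z)\<bar> \<le> indicator {..r + h} (fst z) * B"
          using B v_bounds[of z] by (intro mult_mono) auto
        thus "norm (bump (l n) h (fst z - r) * \<Psi> r (v z)) \<le> B * indicator {..r + h} (fst z)"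
          by (simp add: abs_mult mult.commute)
      qed
    qed measurable
  qed
  show ?thesis
  proof (rule LIMSEQ_le[OF lim lim])
    show "\<exists>N. \<forall>n\<ge>N. (\<integral>z. bump (l n) h (fst z - t) * \<Psi> t (v z) \<partial>spacetime d)
        \<le> (\<integral>z. bump (l n) h (fst z - s) * \<Psi> s (v z) \<partial>spacetime d)"
      using smoothed_window_antimono[OF convex der cont cont_t ineq st _ h] by (auto simp: l_def)
  qed (use st in auto)
qed

end

section \<open>Moving barriers\<close>

context averaged_solution
begin

lemma AE_zero_after:
  fixes f :: "real \<Rightarrow> real"
  assumes f: "continuous_on UNIV f" "\<And>\<xi>. 0 \<le> f \<xi>"
    and le: "\<And>h. h > 0 \<Longrightarrow> (\<integral>z. indicator {t<..<t+h} (fst z) * f (v z) \<partial>spacetime d) \<le> 0"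
  shows "AE z in spacetime d. t < fst z \<longrightarrow> f (v z) = 0"
proof -
  have "AE z in spacetime d. indicator {t<..<t + real (Suc n)} (fst z) * f (v z) = 0" for n
  proof -
    have int: "integrable (spacetime d) (\<lambda>z. indicator {t<..<t + real (Suc n)} (fst z) * f (v z))"
      by (rule integrable_profile[OF f(1), where B = 1 and R = "t + real (Suc n)"])
         (auto simp: indicator_def)
    have nn: "AE z in spacetime d. 0 \<le> indicator {t<..<t + real (Suc n)} (fst z) * f (v z)"
      using f(2) by simp
    have "(\<integral>z. indicator {t<..<t + real (Suc n)} (fst z) * f (v z) \<partial>spacetime d) = 0"
      using le[of "real (Suc n)"] integral_nonneg_AE[OF nn] by simp
    thus ?thesis using integral_nonneg_eq_0_iff_AE[OF int nn] by simp
  qed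
  hence "AE z in spacetime d. \<forall>n. indicator {t<..<t + real (Suc n)} (fst z) * f (v z) = 0"
    by (intro AE_all_countable[THEN iffD2] allI)
  thus ?thesis
  proof eventually_elim
    case (elim z)
    show ?case
    proof
      assume z: "t < fst z"
      obtain n where "fst z - t < real (Suc n)" using reals_Archimedean2 less_SucI
        by (metis less_trans lessI of_nat_less_iff)
      with elim[rule_format, of n] z show "f (v z) = 0" by simp
    qed
  qed
qed

text \<open>
  The excess over the level is measured by the cube of the positive part, which is of class $C^2$. Where
  \<open>\<xi> > c\<close>, its time derivative is \<open>- c'\<close> times $\eta'$, and the product of \<open>H\<close> with \<open>\<xi> - b\<close> is at
  least $c^m (c - b) \eta'$. At a time \<open>s\<close> with \<open>c s \<ge> M\<close> there is no excess.
\<close>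

lemma upper_barrier:
  fixes c c' :: "real \<Rightarrow> real"
  assumes der: "\<And>t. t > 0 \<Longrightarrow> (c has_real_derivative c' t) (at t)"
    and cont: "continuous_on {0<..} c'"
    and cb: "\<And>t. t > 0 \<Longrightarrow> b \<le> c t" "\<And>t. t > 0 \<Longrightarrow> 0 \<le> c t"
    and ode: "\<And>t. t > 0 \<Longrightarrow> - c' t \<le> c t powr m * (c t - b)"
    and init: "\<And>t. t > 0 \<Longrightarrow> \<exists>s. 0 < s \<and> s \<le> t \<and> M \<le> c s"
    and t: "t > 0"
  shows "AE z in spacetime d. t < fst z \<longrightarrow> v z \<le> c t"
proof -
  obtain s where s: "0 < s" "s \<le> t" "M \<le> c s" using init[OF t] by blast
  have ccont: "continuous_on {0<..} c"
    using der DERIV_isCont by (fastforce simp: continuous_on_eq_continuous_at)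
  have cont1: "continuous_on ({0<..<t+1} \<times> UNIV) (\<lambda>p. c (fst p))"
    by (rule continuous_on_compose2[OF ccont]) (auto intro!: continuous_intros)
  have cont2: "continuous_on ({0<..<t+1} \<times> UNIV) (\<lambda>p. c' (fst p))"
    by (rule continuous_on_compose2[OF cont]) (auto intro!: continuous_intros)
  have "(\<integral>z. indicator {t<..<t+h} (fst z) * max 0 (v z - c t) ^ 3 \<partial>spacetime d) \<le> 0" if h: "h > 0" for h
  proof -
    have "(\<integral>z. indicator {t<..<t+h} (fst z) * max 0 (v z - c t) ^ 3 \<partial>spacetime d)
       \<le> (\<integral>z. indicator {s<..<s+h} (fst z) * max 0 (v z - c s) ^ 3 \<partial>spacetime d)"
    proof (rule window_antimono[where T = "t + 1" and \<Psi> = "\<lambda>t \<xi>. max 0 (\<xi> - c t) ^ 3"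
          and \<Psi>t = "\<lambda>t \<xi>. - c' t * (3 * (max 0 (\<xi> - c t))\<^sup>2)" and a = "\<lambda>_. 0", OF C2_convex_upper])
      fix r \<xi> :: real assume r: "0 < r" "r < t + 1"
      have 3: "((\<lambda>x::real. max 0 x ^ 3) has_real_derivative 3 * (max 0 y)\<^sup>2) (at y)" for y
        using pos_part_power_has_derivative[of 1 y] by (simp add: eval_nat_numeral)
      have "((\<lambda>s. \<xi> - c s) has_real_derivative - c' r) (at r)"
        using der[OF r(1)] by (auto intro!: derivative_eq_intros)
      from DERIV_chain2[OF 3 this]
      show "((\<lambda>s. max 0 (\<xi> - c s) ^ 3) has_real_derivative - c' r * (3 * (max 0 (\<xi> - c r))\<^sup>2)) (at r)"
        by (simp add: mult_ac)
      assume \<xi>: "0 \<le> \<xi>"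
      let ?H = "dissip m (\<lambda>\<xi>. 6 * max 0 (\<xi> - c r)) \<xi>"
      show "- c' r * (3 * (max 0 (\<xi> - c r))\<^sup>2) + (0 - ?H) * (\<xi> - b) \<le> 0"
      proof (cases "\<xi> \<le> c r")
        case True
        thus ?thesis using dissip_upper(2)[OF m_pos cb(2)[OF r(1)] \<xi>] by simp
      next
        case False
        let ?q = "3 * (max 0 (\<xi> - c r))\<^sup>2"
        have H: "c r powr m * ?q \<le> ?H" by (rule dissip_upper(1)[OF m_pos cb(2)[OF r(1)] \<xi>])
        have "- c' r * ?q \<le> (c r powr m * (c r - b)) * ?q"
          by (intro mult_right_mono ode r) auto
        also have "\<dots> = (c r powr m * ?q) * (c r - b)" by simp
        also have "\<dots> \<le> (c r powr m * ?q) * (\<xi> - b)"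
          using False by (intro mult_left_mono) auto
        also have "\<dots> \<le> ?H * (\<xi> - b)"
          using H False cb(1)[OF r(1)] by (intro mult_right_mono) auto
        finally show ?thesis by simp
      qed
    qed (use s h in \<open>auto simp: case_prod_unfold intro!: continuous_intros cont1 cont2\<close>)
    also have "max 0 (v z - c s) = 0" for z using v_bounds(2)[of z] s(3) by simp
    hence "(\<integral>z. indicator {s<..<s+h} (fst z) * max 0 (v z - c s) ^ 3 \<partial>spacetime d) = 0" by simp
    finally show ?thesis .
  qed
  hence "AE z in spacetime d. t < fst z \<longrightarrow> max 0 (v z - c t) ^ 3 = 0"
    by (intro AE_zero_after[where f = "\<lambda>a. max 0 (a - c t) ^ 3"] continuous_intros) auto
  thus ?thesis by eventually_elim (auto simp: max_def split: if_splits)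
qed

text \<open>
  Subtracting the value of the dissipation at the level itself makes both terms of the condition vanish for
  \<open>\<xi> \<ge> c\<close>; below the level \<open>dissip_lower\<close> yields the factor $c^m (b - c)$. The initial
  deficit is at most $c(s)^3$, whatever \<open>v\<close> is. The bound at time \<open>t\<close> persists for all later times because the
  window may be arbitrarily long.
\<close>

lemma lower_barrier:
  fixes c c' :: "real \<Rightarrow> real"
  assumes m1: "m < 1"
    and der: "\<And>t. 0 < t \<Longrightarrow> t < T \<Longrightarrow> (c has_real_derivative c' t) (at t)"
    and cont: "continuous_on {0<..<T} c'"
    and cb: "\<And>t. 0 < t \<Longrightarrow> t < T \<Longrightarrow> 0 < c t" "\<And>t. 0 < t \<Longrightarrow> t < T \<Longrightarrow> c t \<le> b"
    and ode: "\<And>t. 0 < t \<Longrightarrow> t < T \<Longrightarrow> 3 * c' t \<le> c t powr m * (b - c t)"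
    and init: "(c \<longlongrightarrow> 0) (at_right 0)"
    and t: "0 < t" "t < T"
  shows "AE z in spacetime d. t < fst z \<longrightarrow> c t \<le> v z"
proof -
  have ccont: "continuous_on {0<..<T} c"
    using der DERIV_isCont by (fastforce simp: continuous_on_eq_continuous_at)
  have cont1: "continuous_on ({0<..<T} \<times> UNIV) (\<lambda>p. c (fst p))"
    by (rule continuous_on_compose2[OF ccont]) (auto intro!: continuous_intros)
  have cont2: "continuous_on ({0<..<T} \<times> UNIV) (\<lambda>p. c' (fst p))"
    by (rule continuous_on_compose2[OF cont]) (auto intro!: continuous_intros)
  have "(\<integral>z. indicator {t<..<t+h} (fst z) * max 0 (c t - v z) ^ 3 \<partial>spacetime d) \<le> 0" if h: "h > 0" for h
  proof (rule tendsto_lowerbound)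
    let ?W = "\<lambda>z. indicator {..t+h} (fst z) * 1 :: real"
    have intW: "integrable (spacetime d) ?W"
      using integrable_spacetime_indicator[of d 1 "t + h"] by simp
    show "((\<lambda>s. c s ^ 3 * (\<integral>z. ?W z \<partial>spacetime d)) \<longlongrightarrow> 0) (at_right 0)"
      using tendsto_mult_right[OF tendsto_power[OF init, of 3]] by (auto intro!: tendsto_eq_intros init)
    have "(\<integral>z. indicator {t<..<t+h} (fst z) * max 0 (c t - v z) ^ 3 \<partial>spacetime d)
        \<le> c s ^ 3 * (\<integral>z. ?W z \<partial>spacetime d)" if s: "0 < s" "s < t" for s
    proof -
      have sT: "s < T" using s t by simp
      have "(\<integral>z. indicator {t<..<t+h} (fst z) * max 0 (c t - v z) ^ 3 \<partial>spacetime d)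
         \<le> (\<integral>z. indicator {s<..<s+h} (fst z) * max 0 (c s - v z) ^ 3 \<partial>spacetime d)"
      proof (rule window_antimono[where T = T and \<Psi> = "\<lambda>t \<xi>. max 0 (c t - \<xi>) ^ 3"
            and \<Psi>t = "\<lambda>t \<xi>. c' t * (3 * (max 0 (c t - \<xi>))\<^sup>2)"
            and a = "\<lambda>t. dissip m (\<lambda>\<xi>. 6 * max 0 (c t - \<xi>)) (c t)", OF C2_convex_lower])
        fix r \<xi> :: real assume r: "0 < r" "r < T"
        have 3: "((\<lambda>x::real. max 0 x ^ 3) has_real_derivative 3 * (max 0 y)\<^sup>2) (at y)" for y
          using pos_part_power_has_derivative[of 1 y] by (simp add: eval_nat_numeral)
        have "((\<lambda>s. c s - \<xi>) has_real_derivative c' r) (at r)"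
          using der[OF r] by (auto intro!: derivative_eq_intros)
        from DERIV_chain2[OF 3 this]
        show "((\<lambda>s. max 0 (c s - \<xi>) ^ 3) has_real_derivative c' r * (3 * (max 0 (c r - \<xi>))\<^sup>2)) (at r)"
          by (simp add: mult_ac)
        assume \<xi>: "0 \<le> \<xi>"
        let ?H = "dissip m (\<lambda>\<xi>. 6 * max 0 (c r - \<xi>))"
        show "c' r * (3 * (max 0 (c r - \<xi>))\<^sup>2) + (?H (c r) - ?H \<xi>) * (\<xi> - b) \<le> 0"
        proof (cases "\<xi> \<le> c r")
          case False
          thus ?thesis using dissip_lower(2)[OF m_pos m1 cb(1)[OF r] \<xi>] by simp
        next
          case True
          have H: "c r powr m * (c r - \<xi>)\<^sup>2 \<le> ?H (c r) - ?H \<xi>"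
            by (rule dissip_lower(1)[OF m_pos m1 cb(1)[OF r] \<xi> True])
          have "c' r * (3 * (max 0 (c r - \<xi>))\<^sup>2) = (3 * c' r) * (c r - \<xi>)\<^sup>2"
            using True by (simp add: max_def)
          also have "\<dots> \<le> (c r powr m * (b - c r)) * (c r - \<xi>)\<^sup>2"
            by (intro mult_right_mono ode r) auto
          also have "\<dots> = (c r powr m * (c r - \<xi>)\<^sup>2) * (b - c r)" by simp
          also have "\<dots> \<le> (c r powr m * (c r - \<xi>)\<^sup>2) * (b - \<xi>)"
            using True by (intro mult_left_mono) auto
          also have "\<dots> \<le> (?H (c r) - ?H \<xi>) * (b - \<xi>)"
            using H True cb(2)[OF r] by (intro mult_right_mono) auto
          finally show ?thesis by (simp add: algebra_simps)
        qed
      qed (use s t h in \<open>auto simp: case_prod_unfold intro!: continuous_intros cont1 cont2\<close>)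
      also have "\<dots> \<le> (\<integral>z. c s ^ 3 * ?W z \<partial>spacetime d)"
      proof (rule integral_mono)
        show "integrable (spacetime d) (\<lambda>z. indicator {s<..<s+h} (fst z) * max 0 (c s - v z) ^ 3)"
          by (rule integrable_profile[where B = 1 and R = "s + h"])
             (auto simp: indicator_def intro!: continuous_intros)
        show "integrable (spacetime d) (\<lambda>z. c s ^ 3 * ?W z)" using intW by simp
        show "indicator {s<..<s+h} (fst z) * max 0 (c s - v z) ^ 3 \<le> c s ^ 3 * ?W z" for z
        proof -
          have "max 0 (c s - v z) \<le> c s" using v_bounds(1)[of z] cb(1)[OF s(1) sT] by simp
          hence "max 0 (c s - v z) ^ 3 \<le> c s ^ 3" by (intro power_mono) auto
          thus ?thesis using s cb(1)[OF s(1) sT] by (auto simp: indicator_def)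
        qed
      qed
      also have "\<dots> = c s ^ 3 * (\<integral>z. ?W z \<partial>spacetime d)" by simp
      finally show ?thesis .
    qed
    moreover have "\<forall>\<^sub>F s in at_right 0. 0 < s \<and> s < t"
      using t(1) eventually_at_right_field by blast
    ultimately show "\<forall>\<^sub>F s in at_right 0. (\<integral>z. indicator {t<..<t+h} (fst z) * max 0 (c t - v z) ^ 3 \<partial>spacetime d)
        \<le> c s ^ 3 * (\<integral>z. ?W z \<partial>spacetime d)"
      by (auto elim!: eventually_mono)
  qed simp
  hence "AE z in spacetime d. t < fst z \<longrightarrow> max 0 (c t - v z) ^ 3 = 0"
    by (intro AE_zero_after[where f = "\<lambda>a. max 0 (c t - a) ^ 3"] continuous_intros) auto
  thus ?thesis by eventually_elim (auto simp: max_def split: if_splits)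
qed

text \<open>
  One null set serves all rational times, and continuity of \<open>c\<close> extends the bound to all times up to that of the
  point, including it. The sign \<open>\<sigma>\<close> covers upper and lower barriers.
\<close>

lemma AE_le_barrier_limit:
  fixes c :: "real \<Rightarrow> real" and \<sigma> :: real and T :: ereal
  assumes bar: "\<And>t. 0 < t \<Longrightarrow> ereal t < T \<Longrightarrow> AE z in spacetime d. t < fst z \<longrightarrow> \<sigma> * v z \<le> c t"
    and cont: "continuous_on {0<..} c"
  shows "AE z in spacetime d. \<forall>\<tau>>0. \<tau> \<le> fst z \<longrightarrow> ereal \<tau> \<le> T \<longrightarrow> \<sigma> * v z \<le> c \<tau>"
proof -
  have "AE z in spacetime d. \<forall>t\<in>{t\<in>\<rat>. 0 < t \<and> ereal t < T}. t < fst z \<longrightarrow> \<sigma> * v z \<le> c t"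
  proof (subst AE_ball_countable)
    show "countable {t\<in>\<rat>. 0 < t \<and> ereal t < T}" by (rule countable_subset[OF _ countable_rat]) auto
  qed (use bar in auto)
  thus ?thesis
  proof eventually_elim
    case (elim z)
    show ?case
    proof (intro allI impI, rule ccontr)
      fix \<tau> assume \<tau>: "\<tau> > 0" "\<tau> \<le> fst z" "ereal \<tau> \<le> T" "\<not> \<sigma> * v z \<le> c \<tau>"
      have "isCont c \<tau>" using cont \<tau>(1) by (simp add: continuous_on_eq_continuous_at)
      hence "\<forall>\<^sub>F t in at_left \<tau>. c t < \<sigma> * v z"
        using \<tau>(4) by (intro order_tendstoD(2)[of c "c \<tau>"]) (auto simp: isCont_def intro: filterlim_at_split[THEN iffD1, THEN conjunct1])
      then obtain p where p: "p < \<tau>" "\<And>t. p < t \<Longrightarrow> t < \<tau> \<Longrightarrow> c t < \<sigma> * v z"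
        unfolding eventually_at_left_field by blast
      obtain q where q: "q \<in> \<rat>" "max p 0 < q" "q < \<tau>"
        using Rats_dense_in_real[of "max p 0" \<tau>] p(1) \<tau>(1) by auto
      hence "ereal q < T" using \<tau>(3) by (meson ereal_less_eq(3) less_le_trans less_ereal.simps(1))
      thus False using elim[rule_format, of q] p(2)[of q] q \<tau> by auto
    qed
  qed
qed

text \<open>
  With $s = (mt)^{-1/m}$ the barrier is \<open>c = b + s\<close>, and $- c' = s^{m+1} \le c^m s = c^m (c - b)$.
\<close>

theorem instantaneous_regularization:
  "AE z in spacetime d. 0 < fst z \<longrightarrow> v z \<le> b + (m * fst z) powr (- 1 / m)"
proof -
  define c where "c = (\<lambda>t. b + (m * t) powr (- 1 / m))"
  define c' where "c' = (\<lambda>t. - ((m * t) powr (- 1 / m - 1)))"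
  have cont': "continuous_on {0<..} c'"
    unfolding c'_def using m_pos by (intro continuous_intros) auto
  have cont: "continuous_on {0<..} c"
    unfolding c_def using m_pos by (intro continuous_intros) auto
  have bar: "AE z in spacetime d. t < fst z \<longrightarrow> v z \<le> c t" if "t > 0" for t
  proof (rule upper_barrier[OF _ cont' _ _ _ _ that])
    fix t :: real assume t: "t > 0"
    have "((\<lambda>t. m * t) has_real_derivative m) (at t)" by (auto intro!: derivative_eq_intros)
    have "((\<lambda>t. (m * t) powr (- 1 / m)) has_real_derivative - 1 / m * (m * t) powr (- 1 / m - 1) * m) (at t)"
      by (rule DERIV_chain2[OF has_real_derivative_powr \<open>((\<lambda>t. m * t) has_real_derivative m) (at t)\<close>])
         (use m_pos t in simp)
    moreover have "- 1 / m * y * m = - y" for y using m_pos by simp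
    ultimately have "((\<lambda>t. (m * t) powr (- 1 / m)) has_real_derivative c' t) (at t)"
      by (simp only: c'_def)
    from DERIV_add[OF DERIV_const[of b] this] show "(c has_real_derivative c' t) (at t)"
      by (simp add: c_def)
    show cb: "b \<le> c t" by (simp add: c_def)
    thus "0 \<le> c t" using b_nonneg by simp
    have "(m * t) powr (- 1 / m - 1) = ((m * t) powr (- 1 / m)) powr m * (m * t) powr (- 1 / m)"
      using m_pos t by (simp add: powr_powr powr_diff)
    also have "\<dots> \<le> c t powr m * (m * t) powr (- 1 / m)"
      using b_nonneg m_pos by (intro mult_right_mono powr_mono2) (auto simp: c_def)
    finally show "- c' t \<le> c t powr m * (c t - b)" by (simp add: c'_def c_def)
    \<comment> \<open>At time $K^{-m} / m$ the singular part of the barrier equals \<open>K\<close>, which is at least \<open>M\<close>.\<close>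
    define K where "K = max M 1"
    define s where "s = min t (K powr (- m) / m)"
    have K: "K \<ge> 1" "M \<le> K" by (auto simp: K_def)
    hence s: "0 < s" "s \<le> t" using t m_pos by (auto simp: s_def)
    have "m * s \<le> K powr (- m)" using m_pos by (simp add: s_def min_def field_simps)
    hence "(K powr (- m)) powr (- 1 / m) \<le> (m * s) powr (- 1 / m)"
      using m_pos s by (intro powr_mono2') auto
    hence "K \<le> (m * s) powr (- 1 / m)" using K m_pos by (simp add: powr_powr)
    hence "M \<le> c s" using K b_nonneg by (simp add: c_def)
    thus "\<exists>s. 0 < s \<and> s \<le> t \<and> M \<le> c s" using s by blast
  qed
  have "AE z in spacetime d. \<forall>\<tau>>0. \<tau> \<le> fst z \<longrightarrow> ereal \<tau> \<le> \<infinity> \<longrightarrow> 1 * v z \<le> c \<tau>"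
    by (rule AE_le_barrier_limit[OF _ cont]) (use bar in simp)
  thus ?thesis by eventually_elim (simp add: c_def)
qed

text \<open>
  While \<open>c \<le> b / 2\<close>, the condition on the barrier follows from $c' = c^m b / 6$, whose solution starting at 0
  is $c(t) = ((1 - m) b t / 6)^{1/(1-m)}$. The time \<open>T\<close> at which it reaches \<open>b / 2\<close> ends the construction; later points inherit
  the bound at \<open>T\<close>.
\<close>

theorem lower_bound:
  assumes m1: "m < 1" and b: "b > 0"
  shows "AE z in spacetime d. 0 < fst z \<longrightarrow>
    min (((1 - m) / 6) powr (1 / (1 - m)) * (b * fst z) powr (1 / (1 - m))) (b / 2) \<le> v z"
proof -
  define k where "k = (1 - m) * b / 6"
  define e where "e = 1 / (1 - m)"
  define c where "c = (\<lambda>t. (k * t) powr e)"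
  define c' where "c' = (\<lambda>t. b / 6 * (k * t) powr (e - 1))"
  define T where "T = (b / 2) powr (1 - m) / k"
  have k: "k > 0" using m1 b by (simp add: k_def)
  have e: "e > 0" "e * (1 - m) = 1" "e * m = e - 1" using m1 by (auto simp: e_def field_simps)
  have T: "T > 0" using b k by (simp add: T_def)
  have cT: "c T = b / 2"
    using k b e by (simp add: c_def T_def powr_powr mult.commute)
  have c_le: "c t \<le> b / 2" if "0 < t" "t \<le> T" for t
    unfolding cT[symmetric] c_def using that k e by (intro powr_mono2 mult_left_mono) auto
  have cont': "continuous_on {0<..<T} c'"
    unfolding c'_def using k by (intro continuous_intros) auto
  have cont: "continuous_on {0<..} (\<lambda>t. - c t)"
    unfolding c_def using k by (intro continuous_intros) auto
  have bar: "AE z in spacetime d. t < fst z \<longrightarrow> c t \<le> v z" if "0 < t" "t < T" for t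
  proof (rule lower_barrier[OF m1 _ cont' _ _ _ _ that])
    show "(c \<longlongrightarrow> 0) (at_right 0)"
      unfolding c_def using k e
      by (auto intro!: tendsto_eq_intros simp: eventually_at_filter)
  next
    fix t assume t: "0 < t" "t < T"
    have "((\<lambda>t. k * t) has_real_derivative k) (at t)" by (auto intro!: derivative_eq_intros)
    from DERIV_chain2[OF has_real_derivative_powr this, of e] k t
    have "((\<lambda>t. (k * t) powr e) has_real_derivative (e * k) * (k * t) powr (e - 1)) (at t)"
      by (simp add: mult_ac)
    moreover have "e * k = b / 6" using e(2) by (simp add: k_def mult.assoc[symmetric])
    ultimately show "(c has_real_derivative c' t) (at t)"
      by (simp add: c_def[abs_def] c'_def)
    show "0 < c t" using k t by (simp add: c_def)
    show "c t \<le> b" using c_le[of t] t b by simp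
    have "3 * c' t = c t powr m * (b / 2)"
      using e by (simp add: c'_def c_def powr_powr)
    also have "\<dots> \<le> c t powr m * (b - c t)"
      using c_le[of t] t by (intro mult_left_mono) auto
    finally show "3 * c' t \<le> c t powr m * (b - c t)" .
  qed
  have "AE z in spacetime d. \<forall>\<tau>>0. \<tau> \<le> fst z \<longrightarrow> ereal \<tau> \<le> ereal T \<longrightarrow> - 1 * v z \<le> - c \<tau>"
    by (rule AE_le_barrier_limit[OF _ cont]) (use bar in simp)
  thus ?thesis
  proof eventually_elim
    case (elim z)
    show ?case
    proof
      assume z: "0 < fst z"
      have "c (min (fst z) T) \<le> v z" using elim[rule_format, of "min (fst z) T"] z T by simp
      moreover have "((1 - m) / 6) powr (1 / (1 - m)) * (b * fst z) powr (1 / (1 - m)) = c (fst z)"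
        using m1 b z by (simp add: c_def k_def e_def powr_mult[symmetric] mult.assoc)
      ultimately show "min (((1 - m) / 6) powr (1 / (1 - m)) * (b * fst z) powr (1 / (1 - m))) (b / 2) \<le> v z"
        by (cases "fst z \<le> T") (auto simp: cT)
    qed
  qed
qed

end

section \<open>Decay of convex functionals and of Lebesgue norms\<close>

lemma Lp_norm_cong_AE:
  assumes [measurable]: "f \<in> borel_measurable (torus d)" "g \<in> borel_measurable (torus d)"
    and eq: "AE x in torus d. f x = g x"
  shows "Lp_norm d p f = Lp_norm d p g"
proof -
  have "esssup (torus d) (\<lambda>x. ereal \<bar>f x\<bar>) = esssup (torus d) (\<lambda>x. ereal \<bar>g x\<bar>)"
    using eq by (intro esssup_AE_cong) auto
  moreover have "integrable (torus d) (\<lambda>x. \<bar>f x\<bar> powr r) \<longleftrightarrow> integrable (torus d) (\<lambda>x. \<bar>g x\<bar> powr r)" for r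
    by (rule integrable_cong_AE) (use eq in auto)
  moreover have "(LINT x|torus d. \<bar>f x\<bar> powr r) = (LINT x|torus d. \<bar>g x\<bar> powr r)" for r
    by (rule integral_cong_AE) (use eq in auto)
  ultimately show ?thesis by (simp add: Lp_norm_def)
qed

context averaged_solution
begin

text \<open>
  Subtracting the dissipation at \<open>b\<close> makes the product with \<open>\<xi> - b\<close> have a sign, by monotonicity.
\<close>

lemma entropy_window_antimono:
  assumes \<eta>: "C2_convex \<eta> \<eta>' \<eta>''" and st: "0 < s" "s \<le> t" and h: "h > 0"
  shows "(\<integral>z. indicator {t<..<t+h} (fst z) * \<eta> (v z) \<partial>spacetime d)
      \<le> (\<integral>z. indicator {s<..<s+h} (fst z) * \<eta> (v z) \<partial>spacetime d)"
proof (rule window_antimono[where T = "t + 1" and \<Psi>t = "\<lambda>_ _. 0" and a = "\<lambda>_. dissip m \<eta>'' b", OF \<eta>])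
  note \<eta>D = \<eta>[unfolded C2_convex_def]
  have "continuous_on UNIV \<eta>"
    by (rule C2_convex_continuous(1)[OF \<eta>])
  hence "continuous_on ({0<..<t+1} \<times> UNIV) (\<lambda>p. \<eta> (snd p))"
    by (rule continuous_on_compose2) (auto intro!: continuous_intros)
  thus "continuous_on ({0<..<t+1} \<times> UNIV) (\<lambda>(t, \<xi>). \<eta> \<xi>)" by (simp add: case_prod_unfold)
  fix r \<xi> :: real assume \<xi>: "0 \<le> \<xi>"
  show "0 + (dissip m \<eta>'' b - dissip m \<eta>'' \<xi>) * (\<xi> - b) \<le> 0"
    using dissip_mono[OF m_pos, of \<eta>'' b \<xi>] dissip_mono[OF m_pos, of \<eta>'' \<xi> b] \<eta>D \<xi> b_nonneg
    by (cases "b \<le> \<xi>") (auto simp: mult_le_0_iff)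
qed (use st h in auto)

text \<open>
  The window integrals, divided by \<open>h\<close>, converge to the spatial integral at Lebesgue points.
\<close>

lemma entropy_decreasing:
  assumes \<eta>: "C2_convex \<eta> \<eta>' \<eta>''"
  shows "\<exists>N\<in>null_sets lborel. \<forall>s t. 0 < s \<longrightarrow> s \<le> t \<longrightarrow> s \<notin> N \<longrightarrow> t \<notin> N \<longrightarrow>
    (LINT x|torus d. \<eta> (v (t, x))) \<le> (LINT x|torus d. \<eta> (v (s, x)))"
proof -
  note \<eta>D = \<eta>[unfolded C2_convex_def]
  have c\<eta>: "continuous_on UNIV \<eta>"
    by (rule C2_convex_continuous(1)[OF \<eta>])
  note [measurable] = borel_measurable_continuous_onI[OF c\<eta>]
  obtain B where B: "B \<ge> 0" "\<And>x. x \<in> {0..M} \<Longrightarrow> \<bar>\<eta> x\<bar> \<le> B"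
    using continuous_on_compact_bound[OF c\<eta>, of "{0..M}"] by auto
  have bound: "\<bar>\<eta> (v z)\<bar> \<le> B" for z using B(2)[of "v z"] v_bounds[of z] by simp
  have meas: "(\<lambda>z. \<eta> (v z)) \<in> borel_measurable (spacetime d)" by measurable
  let ?E = "slice d (\<lambda>z. \<eta> (v z))"
  have "AE t in lborel. ((\<lambda>h. (LINT r:{t<..<t+h}|lborel. ?E r) / h) \<longlongrightarrow> ?E t) (at_right 0)"
    by (rule lebesgue_right_average[OF measurable_slice[OF meas] slice_bound[OF meas bound B(1)]])
  then obtain N where N: "N \<in> null_sets lborel"
    "{t \<in> space lborel. \<not> ((\<lambda>h. (LINT r:{t<..<t+h}|lborel. ?E r) / h) \<longlongrightarrow> ?E t) (at_right 0)} \<subseteq> N"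
    unfolding eventually_ae_filter by blast
  have lim: "((\<lambda>h. (LINT r:{t<..<t+h}|lborel. ?E r) / h) \<longlongrightarrow> ?E t) (at_right 0)" if "t \<notin> N" for t
    using N(2) that by auto
  show ?thesis
  proof (intro bexI[OF _ N(1)] allI impI)
    fix s t :: real assume st: "0 < s" "s \<le> t" "s \<notin> N" "t \<notin> N"
    have "(LINT r:{t<..<t+h}|lborel. ?E r) / h \<le> (LINT r:{s<..<s+h}|lborel. ?E r) / h" if "h > 0" for h
      using entropy_window_antimono[OF \<eta> st(1,2) that] that
      by (simp add: integral_window(2)[OF meas bound] divide_right_mono)
    hence "\<forall>\<^sub>F h in at_right 0. (LINT r:{t<..<t+h}|lborel. ?E r) / h \<le> (LINT r:{s<..<s+h}|lborel. ?E r) / h"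
      by (auto simp: eventually_at_filter)
    from tendsto_le[OF _ lim[OF st(3)] lim[OF st(4)] this] have "?E t \<le> ?E s" by simp
    thus "(LINT x|torus d. \<eta> (v (t, x))) \<le> (LINT x|torus d. \<eta> (v (s, x)))"
      using st by (simp add: slice_def)
  qed
qed

lemma entropies_decreasing:
  fixes \<eta> \<eta>' \<eta>'' :: "'i::countable \<Rightarrow> real \<Rightarrow> real"
  assumes "\<And>i. C2_convex (\<eta> i) (\<eta>' i) (\<eta>'' i)"
  shows "\<exists>N\<in>null_sets lborel. \<forall>i s t. 0 < s \<longrightarrow> s \<le> t \<longrightarrow> s \<notin> N \<longrightarrow> t \<notin> N \<longrightarrow>
    (LINT x|torus d. \<eta> i (v (t, x))) \<le> (LINT x|torus d. \<eta> i (v (s, x)))"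
proof -
  have "\<forall>i. \<exists>N. N \<in> null_sets lborel \<and> (\<forall>s t. 0 < s \<longrightarrow> s \<le> t \<longrightarrow> s \<notin> N \<longrightarrow> t \<notin> N \<longrightarrow>
      (LINT x|torus d. \<eta> i (v (t, x))) \<le> (LINT x|torus d. \<eta> i (v (s, x))))"
    using entropy_decreasing[OF assms] by blast
  then obtain N where N: "\<And>i. N i \<in> null_sets lborel"
    "\<And>i s t. 0 < s \<Longrightarrow> s \<le> t \<Longrightarrow> s \<notin> N i \<Longrightarrow> t \<notin> N i \<Longrightarrow>
      (LINT x|torus d. \<eta> i (v (t, x))) \<le> (LINT x|torus d. \<eta> i (v (s, x)))"
    by metis
  show ?thesis
    by (rule bexI[of _ "\<Union>i. N i"]) (use N in auto)
qed

lemma measurable_v_section: "t > 0 \<Longrightarrow> (\<lambda>x. v (t, x)) \<in> borel_measurable (torus d)"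
  by (rule measurable_section[OF v_measurable])

text \<open>
  The exponents and the regularization tend to their limits together, so that one dominated convergence
  leads from the rational parameters to \<open>p\<close>.
\<close>

lemma power_integral_limit:
  assumes t: "t > 0" and p: "p \<ge> 1"
    and e: "\<And>n. 0 < e n" "\<And>n. e n \<le> 1" "e \<longlonglongrightarrow> 0"
    and q: "\<And>n. 1 \<le> q n" "\<And>n. q n \<le> p + 1" "q \<longlonglongrightarrow> p"
  shows "(\<lambda>n. LINT x|torus d. ((v (t, x))\<^sup>2 + e n) powr (q n / 2))
     \<longlonglongrightarrow> (LINT x|torus d. \<bar>v (t, x)\<bar> powr p)"
proof -
  interpret prob_space "torus d" by (rule prob_space_torus)
  note [measurable] = measurable_v_section[OF t]
  show ?thesis
  proof (rule integral_dominated_convergence)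
    show "integrable (torus d) (\<lambda>_. (M\<^sup>2 + 1) powr ((p + 1) / 2))" by simp
    show "AE x in torus d. (\<lambda>n. ((v (t, x))\<^sup>2 + e n) powr (q n / 2)) \<longlonglongrightarrow> \<bar>v (t, x)\<bar> powr p"
    proof (rule AE_I2)
      fix x
      let ?y = "v (t, x)"
      have "(\<lambda>n. (?y\<^sup>2 + e n) powr (q n / 2)) \<longlonglongrightarrow> (?y\<^sup>2 + 0) powr (p / 2)"
        using p e by (intro tendsto_powr' tendsto_intros q) (auto intro!: always_eventually less_imp_le add_nonneg_pos)
      also have "(?y\<^sup>2 + 0) powr (p / 2) = \<bar>?y\<bar> powr p"
      proof (cases "?y = 0")
        case False
        hence "(?y\<^sup>2 + 0) powr (p / 2) = (\<bar>?y\<bar> powr 2) powr (p / 2)" by (simp add: powr_numeral)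
        also have "\<dots> = \<bar>?y\<bar> powr p" unfolding powr_powr by simp
        finally show ?thesis .
      qed simp
      finally show "(\<lambda>n. (?y\<^sup>2 + e n) powr (q n / 2)) \<longlonglongrightarrow> \<bar>?y\<bar> powr p" .
    qed
    show "AE x in torus d. norm (((v (t, x))\<^sup>2 + e n) powr (q n / 2)) \<le> (M\<^sup>2 + 1) powr ((p + 1) / 2)" for n
    proof (rule AE_I2)
      fix x
      have "(v (t, x))\<^sup>2 \<le> M\<^sup>2" using v_bounds[of "(t, x)"] by (intro power_mono) auto
      hence "((v (t, x))\<^sup>2 + e n) powr (q n / 2) \<le> (M\<^sup>2 + 1) powr (q n / 2)"
        using e(1)[of n] e(2)[of n] q(1)[of n] by (intro powr_mono2) auto
      also have "\<dots> \<le> (M\<^sup>2 + 1) powr ((p + 1) / 2)"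
        using q(2)[of n] by (intro powr_mono) auto
      finally show "norm (((v (t, x))\<^sup>2 + e n) powr (q n / 2)) \<le> (M\<^sup>2 + 1) powr ((p + 1) / 2)" by simp
    qed
  qed measurable
qed

text \<open>
  A single null set must serve uncountably many exponents. For finite \<open>p\<close> it comes from the entropies with
  rational exponent and \<open>\<epsilon> = 1 / (n + 1)\<close>. For \<open>p = \<infinity>\<close> it comes from the entropies
  $(\xi - k)_+^3$: if \<open>v\<close> does not exceed the rational level \<open>k\<close> at time \<open>s\<close>, it does not at time \<open>t\<close>.
\<close>

theorem Lp_norm_decreasing:
  obtains N where "N \<in> null_sets lborel"
    "\<And>p s t. 1 \<le> p \<Longrightarrow> 0 < s \<Longrightarrow> s \<le> t \<Longrightarrow> s \<notin> N \<Longrightarrow> t \<notin> N \<Longrightarrow>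
      Lp_norm d p (\<lambda>x. v (t, x)) \<le> Lp_norm d p (\<lambda>x. v (s, x))"
proof -
  interpret prob_space "torus d" by (rule prob_space_torus)
  \<comment> \<open>Adding 1 to the absolute value of a rational makes every index an admissible exponent.\<close>
  define pw where "pw = (\<lambda>i::rat \<times> nat. 1 + \<bar>real_of_rat (fst i)\<bar>)"
  define ep where "ep = (\<lambda>i::rat \<times> nat. inverse (real (Suc (snd i))))"
  have "1 \<le> pw i" "0 < ep i" for i by (simp_all add: pw_def ep_def del: of_nat_Suc)
  hence convex: "C2_convex (\<lambda>\<xi>. (\<xi>\<^sup>2 + ep i) powr (pw i / 2)) (\<lambda>\<xi>. pw i * \<xi> * (\<xi>\<^sup>2 + ep i) powr (pw i / 2 - 1))
     (\<lambda>\<xi>. pw i * (\<xi>\<^sup>2 + ep i) powr (pw i / 2 - 2) * ((pw i - 1) * \<xi>\<^sup>2 + ep i))" for i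
    by (intro C2_convex_smoothed_power)
  obtain N1 where N1: "N1 \<in> null_sets lborel"
    "\<forall>i s t. 0 < s \<longrightarrow> s \<le> t \<longrightarrow> s \<notin> N1 \<longrightarrow> t \<notin> N1 \<longrightarrow>
      (LINT x|torus d. ((v (t, x))\<^sup>2 + ep i) powr (pw i / 2)) \<le> (LINT x|torus d. ((v (s, x))\<^sup>2 + ep i) powr (pw i / 2))"
    using entropies_decreasing[OF convex] by (rule bexE)
  obtain N2 where N2: "N2 \<in> null_sets lborel"
    "\<forall>(k::rat) s t. 0 < s \<longrightarrow> s \<le> t \<longrightarrow> s \<notin> N2 \<longrightarrow> t \<notin> N2 \<longrightarrow>
      (LINT x|torus d. max 0 (v (t, x) - real_of_rat k) ^ 3) \<le> (LINT x|torus d. max 0 (v (s, x) - real_of_rat k) ^ 3)"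
    using entropies_decreasing[OF C2_convex_upper, of real_of_rat] by (rule bexE)
  show ?thesis
  proof (rule that[of "N1 \<union> N2"])
    show "N1 \<union> N2 \<in> null_sets lborel" by (rule null_sets.Un[OF N1(1) N2(1)])
    fix p :: ereal and s t :: real
    assume p: "1 \<le> p" and st: "0 < s" "s \<le> t" "s \<notin> N1 \<union> N2" "t \<notin> N1 \<union> N2"
    have t: "t > 0" using st by simp
    note [measurable] = measurable_v_section[OF st(1)] measurable_v_section[OF t]
    show "Lp_norm d p (\<lambda>x. v (t, x)) \<le> Lp_norm d p (\<lambda>x. v (s, x))"
    proof (cases "p = \<infinity>")
      case False
      then obtain r where r: "p = ereal r" "r \<ge> 1" using p by (cases p) auto
      have int: "integrable (torus d) (\<lambda>x. \<bar>v (a, x)\<bar> powr r)" if "a > 0" for a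
      proof (rule integrable_const_bound[of _ "M powr r"])
        have "\<bar>v (a, x)\<bar> powr r \<le> M powr r" for x
          using v_bounds[of "(a, x)"] r by (intro powr_mono2) auto
        thus "AE x in torus d. norm (\<bar>v (a, x)\<bar> powr r) \<le> M powr r" by simp
      qed (use measurable_v_section[OF that] in measurable)
      have "\<exists>q::rat. r - 1 < of_rat q \<and> of_rat q < r - 1 + inverse (real (Suc n))" for n
        by (rule of_rat_dense) simp
      then obtain q :: "nat \<Rightarrow> rat" where q: "\<And>n. r - 1 < of_rat (q n)"
        "\<And>n. of_rat (q n) < r - 1 + inverse (real (Suc n))" by metis
      have inv: "inverse (real (Suc n)) \<le> 1" for n by (simp add: field_simps)
      have pw: "pw (q n, n) = 1 + of_rat (q n)" for n
      proof -
        have "real_of_rat (q n) > 0" using q(1)[of n] r by linarith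
        thus ?thesis unfolding pw_def fst_conv by (simp only: abs_of_pos)
      qed
      have "(\<lambda>n. 1 + real_of_rat (q n)) \<longlonglongrightarrow> r"
      proof (rule tendsto_sandwich[of "\<lambda>_. r" _ _ "\<lambda>n. r + inverse (real (Suc n))"])
        show "(\<lambda>n. r + inverse (real (Suc n))) \<longlonglongrightarrow> r"
          using tendsto_add[OF tendsto_const[of r] LIMSEQ_inverse_real_of_nat] by simp
        show "\<forall>\<^sub>F n in sequentially. r \<le> 1 + real_of_rat (q n)"
          using q(1) by (intro always_eventually allI) (simp add: less_imp_le algebra_simps)
        show "\<forall>\<^sub>F n in sequentially. 1 + real_of_rat (q n) \<le> r + inverse (real (Suc n))"
          using q(2) by (intro always_eventually allI) (simp add: less_imp_le algebra_simps)
      qed simp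
      hence lim: "(\<lambda>n. LINT x|torus d. ((v (a, x))\<^sup>2 + inverse (real (Suc n))) powr ((1 + of_rat (q n)) / 2))
         \<longlonglongrightarrow> (LINT x|torus d. \<bar>v (a, x)\<bar> powr r)" if "a > 0" for a
      proof (intro power_integral_limit that r(2) LIMSEQ_inverse_real_of_nat inv)
        show "1 \<le> 1 + real_of_rat (q n)" "1 + real_of_rat (q n) \<le> r + 1" for n
          using q(1)[of n] q(2)[of n] inv[of n] r(2) by linarith+
      qed auto
      have "(LINT x|torus d. \<bar>v (t, x)\<bar> powr r) \<le> (LINT x|torus d. \<bar>v (s, x)\<bar> powr r)"
      proof (rule LIMSEQ_le[OF lim[OF t] lim[OF st(1)]])
        have "(LINT x|torus d. ((v (t, x))\<^sup>2 + inverse (real (Suc n))) powr ((1 + of_rat (q n)) / 2))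
            \<le> (LINT x|torus d. ((v (s, x))\<^sup>2 + inverse (real (Suc n))) powr ((1 + of_rat (q n)) / 2))" for n
          using N1(2)[rule_format, of s t "(q n, n)"] st by (simp add: pw ep_def del: of_nat_Suc)
        thus "\<exists>N. \<forall>n\<ge>N. (LINT x|torus d. ((v (t, x))\<^sup>2 + inverse (real (Suc n))) powr ((1 + of_rat (q n)) / 2))
            \<le> (LINT x|torus d. ((v (s, x))\<^sup>2 + inverse (real (Suc n))) powr ((1 + of_rat (q n)) / 2))" by blast
      qed
      hence "(LINT x|torus d. \<bar>v (t, x)\<bar> powr r) powr (1 / r) \<le> (LINT x|torus d. \<bar>v (s, x)\<bar> powr r) powr (1 / r)"
        using r(2) by (intro powr_mono2 integral_nonneg_AE) auto
      thus ?thesis using int[OF t] int[OF st(1)] by (simp add: Lp_norm_def r(1))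
    next
      case True
      define e where "e = esssup (torus d) (\<lambda>x. ereal \<bar>v (s, x)\<bar>)"
      have "AE x in torus d. e < ereal (real_of_rat k) \<longrightarrow> v (t, x) \<le> real_of_rat k" for k
      proof (cases "e < ereal (real_of_rat k)")
        case k: True
        have i: "integrable (torus d) (\<lambda>x. max 0 (v (t, x) - real_of_rat k) ^ 3)"
        proof (rule integrable_const_bound[of _ "max 0 (M - real_of_rat k) ^ 3"])
          have "max 0 (v (t, x) - real_of_rat k) ^ 3 \<le> max 0 (M - real_of_rat k) ^ 3" for x
            using v_bounds[of "(t, x)"] by (intro power_mono) auto
          thus "AE x in torus d. norm (max 0 (v (t, x) - real_of_rat k) ^ 3) \<le> max 0 (M - real_of_rat k) ^ 3" by simp
        qed measurable
        have "AE x in torus d. ereal \<bar>v (s, x)\<bar> \<le> e" unfolding e_def by (rule esssup_AE)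
        hence "AE x in torus d. max 0 (v (s, x) - real_of_rat k) ^ 3 = 0"
        proof eventually_elim
          case (elim x)
          hence "ereal \<bar>v (s, x)\<bar> < ereal (real_of_rat k)" using k by (rule le_less_trans)
          thus ?case by simp
        qed
        hence "(LINT x|torus d. max 0 (v (s, x) - real_of_rat k) ^ 3) = (LINT x|torus d. 0)"
          by (intro integral_cong_AE) measurable
        hence "(LINT x|torus d. max 0 (v (t, x) - real_of_rat k) ^ 3) \<le> 0"
          using N2(2)[rule_format, of s t k] st by simp
        moreover have nn: "AE x in torus d. 0 \<le> max 0 (v (t, x) - real_of_rat k) ^ 3" by simp
        ultimately have "(LINT x|torus d. max 0 (v (t, x) - real_of_rat k) ^ 3) = 0"
          using integral_nonneg_AE[OF nn] by simp
        hence "AE x in torus d. max 0 (v (t, x) - real_of_rat k) ^ 3 = 0"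
          using integral_nonneg_eq_0_iff_AE[OF i nn] by simp
        thus ?thesis by eventually_elim (auto simp: max_def split: if_splits)
      qed simp
      hence "AE x in torus d. \<forall>k. e < ereal (real_of_rat k) \<longrightarrow> v (t, x) \<le> real_of_rat k"
        by (intro AE_all_countable[THEN iffD2] allI)
      hence "AE x in torus d. ereal \<bar>v (t, x)\<bar> \<le> e"
      proof eventually_elim
        case (elim x)
        show ?case
        proof (rule ccontr)
          assume "\<not> ereal \<bar>v (t, x)\<bar> \<le> e"
          hence "e < ereal \<bar>v (t, x)\<bar>" by simp
          from ereal_dense3[OF this] obtain k :: rat
            where "e < ereal (real_of_rat k)" "ereal (real_of_rat k) < ereal \<bar>v (t, x)\<bar>" by blast
          thus False using elim v_bounds(1)[of "(t, x)"] by auto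
        qed
      qed
      hence "esssup (torus d) (\<lambda>x. ereal \<bar>v (t, x)\<bar>) \<le> e"
        by (intro esssup_I) measurable
      thus ?thesis using True by (simp add: Lp_norm_def e_def)
    qed
  qed
qed

end

section \<open>The estimates for entropy solutions\<close>

text \<open>
  The representative is \<open>u\<close> clipped to \<open>[0, M]\<close>.
\<close>

lemma entropy_solution_averaged:
  assumes sol: "entropy_solution d m K u0 u" and m: "m > 0"
    and u0: "AE x in torus d. 0 \<le> u0 x"
  obtains M v where "averaged_solution d m (torus_mean d u0) M v"
    "AE z in spacetime d. u (fst z) (snd z) = v z"
proof -
  from sol have bn: "bounded_nonneg d u" and weak: "weak_formulation d m K u0 u"
    and ent: "entropy_inequality d m K u" by (auto simp: entropy_solution_def)
  from bn obtain M' where u: "(\<lambda>(t, x). u t x) \<in> borel_measurable (spacetime d)"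
    and nn: "AE z in spacetime d. 0 \<le> u (fst z) (snd z)" and M': "AE z in spacetime d. u (fst z) (snd z) \<le> M'"
    by (auto simp: bounded_nonneg_def case_prod_unfold)
  define M where "M = max 0 M'"
  define v where "v = (\<lambda>z. max 0 (min M (u (fst z) (snd z))))"
  have [measurable]: "(\<lambda>z. u (fst z) (snd z)) \<in> borel_measurable (spacetime d)"
    using u by (simp add: case_prod_unfold)
  have v: "v \<in> borel_measurable (spacetime d)" unfolding v_def by measurable
  have vb: "0 \<le> v z \<and> v z \<le> M" for z by (auto simp: v_def M_def)
  have eq: "AE z in spacetime d. u (fst z) (snd z) = v z"
    using nn M' by eventually_elim (auto simp: v_def M_def)
  have mean: "AE t in lborel. t > 0 \<longrightarrow> (LINT x|torus d. v (t, x)) = torus_mean d u0"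
    by (rule mean_constant[OF v vb]) (rule weak_formulation_mean[OF weak u v vb eq])
  have "averaged_solution d m (torus_mean d u0) M v"
  proof
    show "0 \<le> torus_mean d u0" using u0 by (simp add: torus_mean_def integral_nonneg_AE)
    fix \<eta> \<eta>' \<eta>'' \<theta> :: "real \<Rightarrow> real" and a R :: real
    assume A: "C2_convex \<eta> \<eta>' \<eta>''" "\<And>k. smooth_upto k \<theta>" "\<And>t. 0 \<le> \<theta> t" "0 < a"
      "\<And>t. t \<notin> {a..R} \<Longrightarrow> \<theta> t = 0"
    show "- (\<integral>z. \<eta> (v z) * deriv \<theta> (fst z) \<partial>spacetime d)
        \<le> - (\<integral>z. \<theta> (fst z) * (dissip m \<eta>'' (v z) * (v z - torus_mean d u0)) \<partial>spacetime d)"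
      by (rule entropy_inequality_time[OF ent u v vb eq mean m A])
  qed (use m v vb mean in auto)
  thus ?thesis using that eq by blast
qed

lemma solution_upper_bound:
  assumes "entropy_solution d m K u0 u" "m > 0" "AE x in torus d. 0 \<le> u0 x"
  shows "AE (t, x) in spacetime d. u t x \<le> torus_mean d u0 + (m * t) powr (- 1 / m)"
proof -
  obtain M v where "averaged_solution d m (torus_mean d u0) M v"
    and eq: "AE z in spacetime d. u (fst z) (snd z) = v z"
    using entropy_solution_averaged[OF assms] .
  interpret averaged_solution d m "torus_mean d u0" M v by fact
  have "AE z in spacetime d. u (fst z) (snd z) \<le> torus_mean d u0 + (m * fst z) powr (- 1 / m)"
    using instantaneous_regularization eq AE_space
    by eventually_elim (simp add: space_spacetime)
  thus ?thesis by (simp add: case_prod_unfold)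
qed

lemma solution_Lp_norm_antimono:
  assumes sol: "entropy_solution d m K u0 u" and "m > 0" "AE x in torus d. 0 \<le> u0 x"
  shows "\<exists>N\<in>null_sets lborel. \<forall>p::ereal. 1 \<le> p \<longrightarrow> antimono_on ({0<..} - N) (\<lambda>t. Lp_norm d p (u t))"
proof -
  obtain M v where "averaged_solution d m (torus_mean d u0) M v"
    and eq: "AE z in spacetime d. u (fst z) (snd z) = v z"
    using entropy_solution_averaged[OF assms] .
  interpret averaged_solution d m "torus_mean d u0" M v by fact
  have u: "(\<lambda>(t, x). u t x) \<in> borel_measurable (spacetime d)"
    using sol by (simp add: entropy_solution_def bounded_nonneg_def)
  obtain N1 where N1: "N1 \<in> null_sets lborel"
    "\<And>p s t. 1 \<le> p \<Longrightarrow> 0 < s \<Longrightarrow> s \<le> t \<Longrightarrow> s \<notin> N1 \<Longrightarrow> t \<notin> N1 \<Longrightarrow>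
      Lp_norm d p (\<lambda>x. v (t, x)) \<le> Lp_norm d p (\<lambda>x. v (s, x))"
    using Lp_norm_decreasing by blast
  have "AE t in lborel. t > 0 \<longrightarrow> (AE x in torus d. u t x = v (t, x))"
    using AE_spacetime_D[OF eq] by simp
  then obtain N2 where N2: "N2 \<in> null_sets lborel"
    "{t \<in> space lborel. \<not> (t > 0 \<longrightarrow> (AE x in torus d. u t x = v (t, x)))} \<subseteq> N2"
    unfolding eventually_ae_filter by blast
  have norm_eq: "Lp_norm d p (u t) = Lp_norm d p (\<lambda>x. v (t, x))" if "t > 0" "t \<notin> N2" for t p
  proof (rule Lp_norm_cong_AE)
    show "u t \<in> borel_measurable (torus d)" using measurable_section[OF u that(1)] by simp
    show "AE x in torus d. u t x = v (t, x)" using N2(2) that by auto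
  qed (rule measurable_v_section[OF that(1)])
  show ?thesis
  proof (intro bexI[of _ "N1 \<union> N2"] allI impI monotone_onI)
    fix p :: ereal and s t
    assume "1 \<le> p" "s \<in> {0<..} - (N1 \<union> N2)" "t \<in> {0<..} - (N1 \<union> N2)" "s \<le> t"
    thus "Lp_norm d p (u s) \<ge> Lp_norm d p (u t)"
      using N1(2)[of p s t] by (simp add: norm_eq)
  qed (rule null_sets.Un[OF N1(1) N2(1)])
qed

text \<open>
  The first entry is the coefficient of the barrier, the second the fraction of \<open>b\<close> at which it stops. The value for
  \<open>m \<ge> 1\<close> only has to be positive.
\<close>

definition barrier_const :: "real \<Rightarrow> real" where
  "barrier_const m = (if m < 1 then min (((1 - m) / 6) powr (1 / (1 - m))) (1 / 2) else 1)"

lemma barrier_const_pos: "barrier_const m > 0"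
  by (simp add: barrier_const_def)

text \<open>
  Since $1 - e^{-Ct} \le 1$, the claim is weaker than the minimum of \<open>lower_bound\<close>.
\<close>

lemma solution_lower_bound:
  assumes "entropy_solution d m K u0 u" "m > 0" "AE x in torus d. 0 \<le> u0 x" and m1: "m < 1"
  defines "b \<equiv> torus_mean d u0" and "C \<equiv> barrier_const m"
  shows "AE (t, x) in spacetime d. C * min ((b * t) powr (1 / (1 - m))) (b * (1 - exp (- C * t))) \<le> u t x"
proof -
  obtain M v where "averaged_solution d m b M v"
    and eq: "AE z in spacetime d. u (fst z) (snd z) = v z"
    using entropy_solution_averaged[OF assms(1-3)] unfolding b_def .
  interpret averaged_solution d m b M v by fact
  have C: "C > 0" "C \<le> ((1 - m) / 6) powr (1 / (1 - m))" "C \<le> 1 / 2"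
    using barrier_const_pos[of m] m1 by (auto simp: C_def barrier_const_def)
  have "AE z in spacetime d. C * min ((b * fst z) powr (1 / (1 - m))) (b * (1 - exp (- C * fst z))) \<le> v z"
  proof (cases "b = 0")
    case True
    thus ?thesis using v_bounds(1) by simp
  next
    case False
    hence b: "b > 0" using b_nonneg by simp
    from lower_bound[OF m1 b] AE_space show ?thesis
    proof eventually_elim
      case (elim z)
      let ?X = "(b * fst z) powr (1 / (1 - m))" and ?Y = "b * (1 - exp (- C * fst z))"
      have t: "fst z > 0" using elim(2) by (simp add: space_spacetime)
      have "C * min ?X ?Y \<le> C * ?X" using C(1) by (intro mult_left_mono) auto
      also have "\<dots> \<le> ((1 - m) / 6) powr (1 / (1 - m)) * ?X"
        using C(2) by (intro mult_right_mono) auto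
      finally have 1: "C * min ?X ?Y \<le> ((1 - m) / 6) powr (1 / (1 - m)) * ?X" .
      have "C * min ?X ?Y \<le> C * b" using C(1) b by (intro mult_left_mono) (auto simp: min_le_iff_disj)
      also have "\<dots> \<le> 1 / 2 * b" using C(3) b by (intro mult_right_mono) auto
      finally have "C * min ?X ?Y \<le> b / 2" by simp
      with 1 show ?case using elim(1) t by linarith
    qed
  qed
  with eq have "AE z in spacetime d. C * min ((b * fst z) powr (1 / (1 - m))) (b * (1 - exp (- C * fst z))) \<le> u (fst z) (snd z)"
    by eventually_elim simp
  thus ?thesis by (simp add: case_prod_unfold)
qed

theorem theorem1p6:
  shows "\<exists>C :: real \<Rightarrow> real \<Rightarrow> real. (\<forall>m b. C m b > 0) \<and>
    (\<forall>(d::nat) (m::real) g K u0 u.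
       d \<ge> 1 \<and> m > 0 \<and> green_kernel d g \<and> weak_gradient d g K \<and>
       integrable (torus d) u0 \<and> (AE x in torus d. 0 \<le> u0 x) \<and>
       entropy_solution d m K u0 u \<longrightarrow>
       (let b = torus_mean d u0 in
         (AE (t, x) in spacetime d. u t x \<le> b + (m * t) powr (- 1 / m)) \<and>
         (\<exists>N\<in>null_sets lborel. \<forall>p::ereal. 1 \<le> p \<longrightarrow>
            antimono_on ({0<..} - N) (\<lambda>t. Lp_norm d p (u t))) \<and>
         (m < 1 \<longrightarrow>
            (AE (t, x) in spacetime d.
               u t x \<ge> C m b * min ((b * t) powr (1 / (1 - m)))
                                   (b * (1 - exp (- C m b * t)))))))"
proof (intro exI[of _ "\<lambda>m b. barrier_const m"] conjI allI impI)
  fix d :: nat and m :: real and g K u0 u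
  assume A: "d \<ge> 1 \<and> m > 0 \<and> green_kernel d g \<and> weak_gradient d g K \<and>
       integrable (torus d) u0 \<and> (AE x in torus d. 0 \<le> u0 x) \<and> entropy_solution d m K u0 u"
  hence *: "entropy_solution d m K u0 u" "m > 0" "AE x in torus d. 0 \<le> u0 x" by auto
  show "let b = torus_mean d u0 in
         (AE (t, x) in spacetime d. u t x \<le> b + (m * t) powr (- 1 / m)) \<and>
         (\<exists>N\<in>null_sets lborel. \<forall>p::ereal. 1 \<le> p \<longrightarrow>
            antimono_on ({0<..} - N) (\<lambda>t. Lp_norm d p (u t))) \<and>
         (m < 1 \<longrightarrow>
            (AE (t, x) in spacetime d.
               u t x \<ge> barrier_const m * min ((b * t) powr (1 / (1 - m)))
                                   (b * (1 - exp (- barrier_const m * t)))))"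
    unfolding Let_def
    using solution_upper_bound[OF *] solution_Lp_norm_antimono[OF *] solution_lower_bound[OF *] by blast
qed (rule barrier_const_pos)

end
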